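(* Let $Z\subset LO(G)$ denote the set of (positive cones of) all dense left orderings of a countable group $G$, and suppose that all rank one abelian subgroups of $G$ are isomorphic to $\mathbb{Z}$. Then if $Z$ is non-empty, its closure $\bar{Z}$ in $LO(G)$ is homeomorphic to the Cantor set, and the set $Z$ is a $G_\delta$ set that is dense in $\bar{Z}$.
   Context: A left ordering of a group $G$ is a strict total ordering $<$ of $G$ such that $g<h$ implies $fg<fh$ for all $f,g,h\in G$. Its positive cone is $P=\{g\in G: g>1\}$. Positive cones are exactly the subsets $P\subset G$ with $PP\subset P$ such that for every $g\in G$ exactly one of $g\in P$, $g^{-1}\in P$, $g=1$ holds; the associated ordering is $g<h$ iff $g^{-1}h\in P$. $LO(G)\subset 2^G$ is the set of all positive cones of $G$, with the subspace topology from the product topology on $2^G$; a subbasis is given by the sets $U_g=\{P\in LO(G): g\in P\}$, $g\in G$. A left ordering is dense if whenever $g<h$ there exists $f\in G$ with $g<f<h$. A $G_\delta$ set is a countable intersection of open sets. The rank of a torsion-free abelian group $A$ is $\dim_{\mathbb{Q}}(A\otimes\mathbb{Q})$. *)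

theory Defs
  imports
    "HOL-Analysis.Analysis"
    "HOL-Algebra.Free_Abelian_Groups"
    "Jordan_Normal_Form.VS_Connect"
begin

section \<open>Left orderings and their positive cones\<close>

definition left_ordering :: "('a, 'b) monoid_scheme \<Rightarrow> ('a \<Rightarrow> 'a \<Rightarrow> bool) \<Rightarrow> bool" where
  "left_ordering G lt \<longleftrightarrow>
     irreflp_on (carrier G) lt \<and> transp_on (carrier G) lt \<and> totalp_on (carrier G) lt \<and>
     (\<forall>f\<in>carrier G. \<forall>g\<in>carrier G. \<forall>h\<in>carrier G.
        lt g h \<longrightarrow> lt (f \<otimes>\<^bsub>G\<^esub> g) (f \<otimes>\<^bsub>G\<^esub> h))"

definition dense_left_ordering :: "('a, 'b) monoid_scheme \<Rightarrow> ('a \<Rightarrow> 'a \<Rightarrow> bool) \<Rightarrow> bool" where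
  "dense_left_ordering G lt \<longleftrightarrow> left_ordering G lt \<and>
     (\<forall>g\<in>carrier G. \<forall>h\<in>carrier G. lt g h \<longrightarrow> (\<exists>f\<in>carrier G. lt g f \<and> lt f h))"

definition positive_cone :: "('a, 'b) monoid_scheme \<Rightarrow> ('a \<Rightarrow> 'a \<Rightarrow> bool) \<Rightarrow> 'a set" where
  "positive_cone G lt = {g \<in> carrier G. lt \<one>\<^bsub>G\<^esub> g}"

definition LO :: "('a, 'b) monoid_scheme \<Rightarrow> 'a set set" where
  "LO G = positive_cone G ` {lt. left_ordering G lt}"

definition dense_LO :: "('a, 'b) monoid_scheme \<Rightarrow> 'a set set" where
  "dense_LO G = positive_cone G ` {lt. dense_left_ordering G lt}"

section \<open>The space of left orderings\<close>

text \<open>The topology on the subsets of \<open>A\<close> obtained by identifying \<open>P \<subseteq> A\<close> with its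
  indicator function in the product of copies of the discrete two-point space.\<close>

definition powerset_topology :: "'a set \<Rightarrow> 'a set topology" where
  "powerset_topology A =
     pullback_topology (Pow A) (\<lambda>P. \<lambda>g\<in>A. g \<in> P)
       (product_topology (\<lambda>_. discrete_topology (UNIV :: bool set)) A)"

definition LO_space :: "('a, 'b) monoid_scheme \<Rightarrow> 'a set topology" where
  "LO_space G = subtopology (powerset_topology (carrier G)) (LO G)"

section \<open>The rank of a torsion-free abelian group\<close>

text \<open>\<open>A \<otimes> \<rat>\<close> is the free abelian group on \<open>A \<times> \<rat>\<close> modulo the bilinearity relations;
  over the integers these already imply that the tensor product is balanced. The group
  operation of \<open>A\<close> is written multiplicatively.\<close>

abbreviation tensor_rat_free ::
  "('a, 'b) monoid_scheme \<Rightarrow> ('a \<times> rat \<Rightarrow>\<^sub>0 int) monoid" where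
  "tensor_rat_free A \<equiv> free_Abelian_group (carrier A \<times> (UNIV :: rat set))"

definition tensor_rat_rel ::
  "('a, 'b) monoid_scheme \<Rightarrow> ('a \<times> rat \<Rightarrow>\<^sub>0 int) set" where
  "tensor_rat_rel A = generate (tensor_rat_free A)
     ({frag_of (a \<otimes>\<^bsub>A\<^esub> b, q) - frag_of (a, q) - frag_of (b, q) | a b q.
         a \<in> carrier A \<and> b \<in> carrier A} \<union>
      {frag_of (a, q + r) - frag_of (a, q) - frag_of (a, r) | a q r. a \<in> carrier A})"

text \<open>Scalar multiplication is induced by \<open>a \<otimes> s \<mapsto> a \<otimes> rs\<close>. The image of a coset under
  this map on the free group need not be a full coset, so it is multiplied by the relation
  subgroup. The ring-theoretic fields \<open>mult\<close> and \<open>one\<close> of the module record carry no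
  meaning.\<close>

definition tensor_rat ::
  "('a, 'b) monoid_scheme \<Rightarrow> (rat, ('a \<times> rat \<Rightarrow>\<^sub>0 int) set) module" where
  "tensor_rat A =
     \<lparr>carrier = carrier (tensor_rat_free A Mod tensor_rat_rel A),
      monoid.mult = undefined, monoid.one = undefined,
      ring.zero = \<one>\<^bsub>tensor_rat_free A Mod tensor_rat_rel A\<^esub>,
      ring.add = monoid.mult (tensor_rat_free A Mod tensor_rat_rel A),
      module.smult = (\<lambda>r X. tensor_rat_rel A <#>\<^bsub>tensor_rat_free A\<^esub>
                 (frag_extend (\<lambda>(a, s). frag_of (a, r * s)) ` X))\<rparr>"

definition torsion_free :: "('a, 'b) monoid_scheme \<Rightarrow> bool" where
  "torsion_free A \<longleftrightarrow>
     (\<forall>a\<in>carrier A. \<forall>n::nat. n > 0 \<and> a [^]\<^bsub>A\<^esub> n = \<one>\<^bsub>A\<^esub> \<longrightarrow> a = \<one>\<^bsub>A\<^esub>)"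

text \<open>The library's \<open>dim\<close> is unspecified for spaces that are not finite-dimensional, hence
  the explicit \<open>fin_dim\<close>.\<close>

definition abelian_of_rank :: "('a, 'b) monoid_scheme \<Rightarrow> nat \<Rightarrow> bool" where
  "abelian_of_rank A n \<longleftrightarrow> comm_group A \<and> torsion_free A \<and>
     vectorspace.fin_dim class_ring (tensor_rat A) \<and>
     vectorspace.dim class_ring (tensor_rat A) = n"

section \<open>The Cantor set\<close>

primrec cantor_stage :: "nat \<Rightarrow> real set" where
  "cantor_stage 0 = {0..1}"
| "cantor_stage (Suc n) =
     (\<lambda>x. x / 3) ` cantor_stage n \<union> (\<lambda>x. (2 + x) / 3) ` cantor_stage n"

definition cantor_set :: "real set" where
  "cantor_set = (\<Inter>n. cantor_stage n)"

end

theory Submission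
  imports Defs
begin

text \<open>An ordering is determined by its positive cone \<open>P\<close>, and the conditions on \<open>P\<close> (closed under
products, exactly one of \<open>g = 1\<close>, \<open>g \<in> P\<close>, \<open>g\<^sup>-\<^sup>1 \<in> P\<close>) each involve finitely many membership
questions. Hence \<open>LO(G)\<close> is closed in the compact space of all subsets of \<open>G\<close>; likewise
density says, for each \<open>g\<close>, that an open condition holds, so for countable \<open>G\<close> the set \<open>Z\<close> of
dense cones is a countable intersection of open sets. The closure of \<open>Z\<close> is compact and has a countable
separating family of clopen sets, so by Brouwer's characterization
(\<open>perfect_clopen_space.homeomorphic_cantor_set\<close>) it is a Cantor set as soon as it has no
isolated points. As \<open>Z\<close> is dense in its closure, this reduces to the algebraic statement
\<open>dense_cone_not_isolated\<close>: if \<open>P\<close> is dense and \<open>F \<subseteq> P\<close> is finite and nonempty, then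
another dense cone contains \<open>F\<close>.

Let \<open>a\<close> be the least element of \<open>F\<close>. The order may be replaced on a convex subgroup without
disturbing the rest (\<open>replace_dense_cone\<close>). If some nontrivial convex subgroup misses \<open>F\<close>,
reversing the order there gives a second cone. Otherwise every nontrivial convex subgroup
contains \<open>a\<close>, so there is a smallest one, \<open>C\<close>, and it suffices to change the order on \<open>C\<close>,
which has no proper nontrivial convex subgroup.

Suppose that this cannot be done. For \<open>1 < g \<le> a\<close> and \<open>f \<in> F\<close> we have \<open>g \<le> f < f g\<close>, that is,
\<open>g\<^sup>-\<^sup>1 f g > 1\<close>; so the conjugate ordering of \<open>C\<close> by \<open>g\<close> is a dense ordering with \<open>F \<inter> C\<close>
positive and therefore equals the given one. The elements bounded by powers of \<open>a\<close> then form
a convex subgroup of order-preserving conjugators, so it is all of \<open>C\<close>, and the order on \<open>C\<close> is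
bi-invariant (\<open>right_invariant_of_isolated\<close>) and archimedean. By Hoelder's theorem \<open>C\<close> embeds
into the additive group of the reals. If the image has rational rank one, then \<open>C\<close> has rank
one in the sense of \<open>C \<otimes> \<rat>\<close>, so by hypothesis it is infinite cyclic and its order is not dense. If the rank is
larger, adding to the embedding a small multiple of a rational functional gives a
different dense ordering that still makes \<open>F \<inter> C\<close> positive (\<open>perturbation\<close>). Both cases are
contradictory.\<close>

section \<open>Positive cones\<close>

definition left_cone :: "('a, 'b) monoid_scheme \<Rightarrow> 'a set \<Rightarrow> bool" where
  "left_cone G P \<longleftrightarrow> P \<subseteq> carrier G \<and> \<one>\<^bsub>G\<^esub> \<notin> P \<and> (\<forall>x\<in>P. \<forall>y\<in>P. x \<otimes>\<^bsub>G\<^esub> y \<in> P) \<and>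
     (\<forall>x\<in>carrier G. x = \<one>\<^bsub>G\<^esub> \<or> x \<in> P \<or> inv\<^bsub>G\<^esub> x \<in> P)"

definition dense_cone :: "('a, 'b) monoid_scheme \<Rightarrow> 'a set \<Rightarrow> bool" where
  "dense_cone G P \<longleftrightarrow> left_cone G P \<and> (\<forall>g\<in>P. \<exists>f\<in>P. inv\<^bsub>G\<^esub> f \<otimes>\<^bsub>G\<^esub> g \<in> P)"

context group
begin

text \<open>Bracketing products to the right and cancelling adjacent inverses brings every group word to
a normal form, so these rules decide the identities between conjugates and quotients that
occur below.\<close>

lemma inv_cancel_left: "\<lbrakk>x \<in> carrier G; y \<in> carrier G\<rbrakk> \<Longrightarrow> inv x \<otimes> (x \<otimes> y) = y"
  by (simp flip: m_assoc)

lemma inv_cancel_left': "\<lbrakk>x \<in> carrier G; y \<in> carrier G\<rbrakk> \<Longrightarrow> x \<otimes> (inv x \<otimes> y) = y"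
  by (simp flip: m_assoc)

lemmas group_normalize = m_assoc inv_mult_group inv_cancel_left inv_cancel_left'

lemma inv_mult_cancel_left:
  "\<lbrakk>f \<in> carrier G; x \<in> carrier G; y \<in> carrier G\<rbrakk> \<Longrightarrow> inv (f \<otimes> x) \<otimes> (f \<otimes> y) = inv x \<otimes> y"
  by (simp add: group_normalize)

lemma left_cone_of_ordering:
  assumes "left_ordering G lt"
  shows "left_cone G (positive_cone G lt)"
proof -
  have irr: "\<not> lt x x" if "x \<in> carrier G" for x
    using assms that by (simp add: left_ordering_def irreflp_on_def)
  have trans: "lt x z" if "lt x y" "lt y z" "x \<in> carrier G" "y \<in> carrier G" "z \<in> carrier G" for x y z
    using assms that unfolding left_ordering_def by (blast dest: transp_onD)
  have total: "x = y \<or> lt x y \<or> lt y x" if "x \<in> carrier G" "y \<in> carrier G" for x y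
    using assms that unfolding left_ordering_def by (blast dest: totalp_onD)
  have left: "lt (f \<otimes> x) (f \<otimes> y)" if "lt x y" "f \<in> carrier G" "x \<in> carrier G" "y \<in> carrier G" for f x y
    using assms that unfolding left_ordering_def by blast
  show ?thesis
    unfolding left_cone_def positive_cone_def
  proof (intro conjI ballI)
    fix x y assume "x \<in> {g \<in> carrier G. lt \<one> g}" "y \<in> {g \<in> carrier G. lt \<one> g}"
    then have x: "x \<in> carrier G" "lt \<one> x" and y: "y \<in> carrier G" "lt \<one> y" by auto
    have "lt x (x \<otimes> y)" using left[OF y(2) x(1)] x y by simp
    then show "x \<otimes> y \<in> {g \<in> carrier G. lt \<one> g}" using trans[OF x(2)] x y by simp
  next
    fix x assume x: "x \<in> carrier G"
    have "lt \<one> (inv x)" if "lt x \<one>" using left[OF that, of "inv x"] x by simp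
    then show "x = \<one> \<or> x \<in> {g \<in> carrier G. lt \<one> g} \<or> inv x \<in> {g \<in> carrier G. lt \<one> g}"
      using total[of x \<one>] x by auto
  qed (use irr in auto)
qed

lemma ordering_of_left_cone:
  assumes "left_cone G P"
  shows "left_ordering G (\<lambda>x y. inv x \<otimes> y \<in> P)"
  unfolding left_ordering_def
proof (intro conjI ballI impI)
  show "irreflp_on (carrier G) (\<lambda>x y. inv x \<otimes> y \<in> P)"
    using assms by (auto simp: irreflp_on_def left_cone_def)
  show "transp_on (carrier G) (\<lambda>x y. inv x \<otimes> y \<in> P)"
  proof (rule transp_onI)
    fix x y z assume xyz: "x \<in> carrier G" "y \<in> carrier G" "z \<in> carrier G"
      and "inv x \<otimes> y \<in> P" "inv y \<otimes> z \<in> P"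
    then have "(inv x \<otimes> y) \<otimes> (inv y \<otimes> z) \<in> P" using assms by (simp add: left_cone_def)
    moreover have "(inv x \<otimes> y) \<otimes> (inv y \<otimes> z) = inv x \<otimes> z"
      using xyz by (simp add: group_normalize)
    ultimately show "inv x \<otimes> z \<in> P" by simp
  qed
  show "totalp_on (carrier G) (\<lambda>x y. inv x \<otimes> y \<in> P)"
  proof (rule totalp_onI)
    fix x y assume xy: "x \<in> carrier G" "y \<in> carrier G" "x \<noteq> y"
    have "inv x \<otimes> y \<noteq> \<one>"
      using xy inv_cancel_left'[of x y] by auto
    then have "inv x \<otimes> y \<in> P \<or> inv (inv x \<otimes> y) \<in> P"
      using assms xy m_closed inv_closed unfolding left_cone_def by blast
    then show "inv x \<otimes> y \<in> P \<or> inv y \<otimes> x \<in> P"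
      using xy by (simp add: inv_mult_group)
  qed
next
  fix f g h assume "f \<in> carrier G" "g \<in> carrier G" "h \<in> carrier G" "inv g \<otimes> h \<in> P"
  then show "inv (f \<otimes> g) \<otimes> (f \<otimes> h) \<in> P" by (simp add: inv_mult_cancel_left)
qed

lemma positive_cone_of_left_cone:
  assumes "left_cone G P"
  shows "positive_cone G (\<lambda>x y. inv x \<otimes> y \<in> P) = P"
  using assms by (auto simp: positive_cone_def left_cone_def)

text \<open>From here on only cones are used: the conditions on a cone are membership conditions, which
is what the topology sees.\<close>

lemma LO_eq: "LO G = {P. left_cone G P}"
proof (intro equalityI subsetI CollectI)
  fix P assume "P \<in> LO G"
  then show "left_cone G P" using left_cone_of_ordering by (auto simp: LO_def)
next
  fix P assume "P \<in> {P. left_cone G P}"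
  then have P: "left_cone G P" by simp
  show "P \<in> LO G"
    unfolding LO_def
    by (rule image_eqI[where x = "\<lambda>x y. inv x \<otimes> y \<in> P"])
      (simp_all add: P positive_cone_of_left_cone ordering_of_left_cone)
qed

text \<open>By left invariance an element between \<open>g\<close> and \<open>h\<close> is \<open>g\<close> times an element between \<open>1\<close> and
\<open>g\<^sup>-\<^sup>1 h\<close>, so density need only be tested at the identity.\<close>

lemma dense_LO_eq: "dense_LO G = {P. dense_cone G P}"
proof (intro equalityI subsetI CollectI)
  fix P assume "P \<in> dense_LO G"
  then obtain lt where lt: "dense_left_ordering G lt" and P: "P = positive_cone G lt"
    by (auto simp: dense_LO_def)
  show "dense_cone G P"
    unfolding dense_cone_def
  proof (intro conjI ballI)
    show "left_cone G P"
      using lt unfolding P dense_left_ordering_def by (blast intro: left_cone_of_ordering)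
    fix g assume "g \<in> P"
    then have g: "g \<in> carrier G" "lt \<one> g" by (auto simp: P positive_cone_def)
    then obtain f where f: "f \<in> carrier G" "lt \<one> f" "lt f g"
      using lt one_closed unfolding dense_left_ordering_def by blast
    then have "lt (inv f \<otimes> f) (inv f \<otimes> g)"
      using lt g unfolding dense_left_ordering_def left_ordering_def by (meson inv_closed)
    then show "\<exists>f\<in>P. inv f \<otimes> g \<in> P"
      using f g by (auto simp: P positive_cone_def)
  qed
next
  fix P assume "P \<in> {P. dense_cone G P}"
  then have P: "left_cone G P" and dense: "\<And>g. g \<in> P \<Longrightarrow> \<exists>f\<in>P. inv f \<otimes> g \<in> P"
    by (auto simp: dense_cone_def)
  have sub: "P \<subseteq> carrier G" using P by (simp add: left_cone_def)
  have "dense_left_ordering G (\<lambda>x y. inv x \<otimes> y \<in> P)"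
    unfolding dense_left_ordering_def
  proof (intro conjI ballI impI ordering_of_left_cone P)
    fix g h assume g: "g \<in> carrier G" and h: "h \<in> carrier G" and "inv g \<otimes> h \<in> P"
    then obtain f where f: "f \<in> P" "inv f \<otimes> (inv g \<otimes> h) \<in> P" using dense by blast
    then have fc: "f \<in> carrier G" using sub by blast
    have "inv g \<otimes> (g \<otimes> f) \<in> P" using g fc f by (simp add: group_normalize)
    moreover have "inv (g \<otimes> f) \<otimes> h \<in> P" using f g h fc by (simp add: group_normalize)
    ultimately show "\<exists>f\<in>carrier G. inv g \<otimes> f \<in> P \<and> inv f \<otimes> h \<in> P"
      using g fc by blast
  qed
  then show "P \<in> dense_LO G"
    unfolding dense_LO_def
    by (intro image_eqI[where x = "\<lambda>x y. inv x \<otimes> y \<in> P"])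
      (simp_all add: P positive_cone_of_left_cone)
qed

lemma left_cone_subgroup_iff:
  assumes "subgroup H G"
  shows "left_cone (G\<lparr>carrier := H\<rparr>) R \<longleftrightarrow> R \<subseteq> H \<and> \<one> \<notin> R \<and> (\<forall>x\<in>R. \<forall>y\<in>R. x \<otimes> y \<in> R) \<and>
     (\<forall>x\<in>H. x = \<one> \<or> x \<in> R \<or> inv x \<in> R)"
  using m_inv_consistent[OF assms] by (auto simp: left_cone_def)

lemma dense_cone_subgroup_iff:
  assumes "subgroup H G"
  shows "dense_cone (G\<lparr>carrier := H\<rparr>) R \<longleftrightarrow>
    left_cone (G\<lparr>carrier := H\<rparr>) R \<and> (\<forall>g\<in>R. \<exists>f\<in>R. inv f \<otimes> g \<in> R)"
proof -
  have "R \<subseteq> H" if "left_cone (G\<lparr>carrier := H\<rparr>) R" using that by (simp add: left_cone_def)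
  then show ?thesis
    unfolding dense_cone_def using m_inv_consistent[OF assms] by (auto simp: subset_iff)
qed

end

section \<open>Left-ordered groups and their convex subgroups\<close>

locale left_ordered_group = group G for G (structure) +
  fixes P :: "'a set"
  assumes cone: "left_cone G P"
begin

definition lt :: "'a \<Rightarrow> 'a \<Rightarrow> bool" (infix "<\<^sub>P" 50) where
  "x <\<^sub>P y \<longleftrightarrow> inv x \<otimes> y \<in> P"

definition le :: "'a \<Rightarrow> 'a \<Rightarrow> bool" (infix "\<le>\<^sub>P" 50) where
  "x \<le>\<^sub>P y \<longleftrightarrow> x = y \<or> x <\<^sub>P y"

lemma P_carrier: "x \<in> P \<Longrightarrow> x \<in> carrier G"
  using cone by (auto simp: left_cone_def)

lemma P_mult: "\<lbrakk>x \<in> P; y \<in> P\<rbrakk> \<Longrightarrow> x \<otimes> y \<in> P"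
  using cone by (simp add: left_cone_def)

lemma one_notin_P: "\<one> \<notin> P"
  using cone by (simp add: left_cone_def)

lemma P_cases: "x \<in> carrier G \<Longrightarrow> x = \<one> \<or> x \<in> P \<or> inv x \<in> P"
  using cone by (simp add: left_cone_def)

lemma P_inv: "x \<in> P \<Longrightarrow> inv x \<notin> P"
  using P_mult[of x "inv x"] one_notin_P P_carrier by auto

lemma one_lt_iff: "x \<in> carrier G \<Longrightarrow> \<one> <\<^sub>P x \<longleftrightarrow> x \<in> P"
  by (simp add: lt_def)

lemma lt_irrefl: "x \<in> carrier G \<Longrightarrow> \<not> x <\<^sub>P x"
  by (simp add: lt_def one_notin_P)

lemma lt_trans: "\<lbrakk>x <\<^sub>P y; y <\<^sub>P z; x \<in> carrier G; y \<in> carrier G; z \<in> carrier G\<rbrakk> \<Longrightarrow> x <\<^sub>P z"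
  using ordering_of_left_cone[OF cone] unfolding left_ordering_def lt_def
  by (blast dest: transp_onD)

lemma lt_total: "\<lbrakk>x \<in> carrier G; y \<in> carrier G\<rbrakk> \<Longrightarrow> x <\<^sub>P y \<or> x = y \<or> y <\<^sub>P x"
  using ordering_of_left_cone[OF cone] unfolding left_ordering_def lt_def
  by (blast dest: totalp_onD)

lemma lt_mult_left: "\<lbrakk>f \<in> carrier G; x \<in> carrier G; y \<in> carrier G\<rbrakk> \<Longrightarrow> f \<otimes> x <\<^sub>P f \<otimes> y \<longleftrightarrow> x <\<^sub>P y"
  by (simp add: lt_def inv_mult_cancel_left)

lemma le_mult_left: "\<lbrakk>f \<in> carrier G; x \<in> carrier G; y \<in> carrier G\<rbrakk> \<Longrightarrow> f \<otimes> x \<le>\<^sub>P f \<otimes> y \<longleftrightarrow> x \<le>\<^sub>P y"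
  by (simp add: le_def lt_mult_left)

lemma le_refl: "x \<le>\<^sub>P x"
  by (simp add: le_def)

lemma le_trans: "\<lbrakk>x \<le>\<^sub>P y; y \<le>\<^sub>P z; x \<in> carrier G; y \<in> carrier G; z \<in> carrier G\<rbrakk> \<Longrightarrow> x \<le>\<^sub>P z"
  unfolding le_def using lt_trans by blast

lemma lt_le_trans: "\<lbrakk>x <\<^sub>P y; y \<le>\<^sub>P z; x \<in> carrier G; y \<in> carrier G; z \<in> carrier G\<rbrakk> \<Longrightarrow> x <\<^sub>P z"
  unfolding le_def using lt_trans by blast

lemma le_lt_trans: "\<lbrakk>x \<le>\<^sub>P y; y <\<^sub>P z; x \<in> carrier G; y \<in> carrier G; z \<in> carrier G\<rbrakk> \<Longrightarrow> x <\<^sub>P z"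
  unfolding le_def using lt_trans by blast

lemma not_lt: "\<lbrakk>x \<in> carrier G; y \<in> carrier G\<rbrakk> \<Longrightarrow> \<not> x <\<^sub>P y \<longleftrightarrow> y \<le>\<^sub>P x"
  unfolding le_def using lt_total lt_trans lt_irrefl by blast

lemma not_le: "\<lbrakk>x \<in> carrier G; y \<in> carrier G\<rbrakk> \<Longrightarrow> \<not> x \<le>\<^sub>P y \<longleftrightarrow> y <\<^sub>P x"
  using not_lt by blast

lemma le_cases: "\<lbrakk>x \<in> carrier G; y \<in> carrier G\<rbrakk> \<Longrightarrow> x \<le>\<^sub>P y \<or> y \<le>\<^sub>P x"
  unfolding le_def using lt_total by blast

lemma finite_has_least:
  assumes "finite F" "F \<noteq> {}" "F \<subseteq> carrier G"
  shows "\<exists>m\<in>F. \<forall>f\<in>F. m \<le>\<^sub>P f"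
  using assms
proof (induction F rule: finite_ne_induct)
  case (singleton x)
  then show ?case by (simp add: le_refl)
next
  case (insert x F)
  then obtain m where m: "m \<in> F" "\<forall>f\<in>F. m \<le>\<^sub>P f" by blast
  have c: "x \<in> carrier G" "m \<in> carrier G" using insert m by auto
  show ?case
  proof (cases "m \<le>\<^sub>P x")
    case True
    then show ?thesis using m by blast
  next
    case False
    then have "x \<le>\<^sub>P m" using le_cases c by blast
    have "x \<le>\<^sub>P f" if "f \<in> F" for f
      using le_trans[OF \<open>x \<le>\<^sub>P m\<close>, of f] m that c insert.prems by auto
    then show ?thesis using le_refl by blast
  qed
qed

text \<open>It is enough to test convexity on elements between \<open>1\<close> and a member: translating an
interval with endpoints in the subgroup moves its lower endpoint to \<open>1\<close>.\<close>

definition convex_subgroup :: "'a set \<Rightarrow> bool" where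
  "convex_subgroup H \<longleftrightarrow> subgroup H G \<and> (\<forall>f\<in>carrier G. \<forall>g\<in>H. \<one> <\<^sub>P f \<longrightarrow> f <\<^sub>P g \<longrightarrow> f \<in> H)"

lemma convex_subgroupD: "\<lbrakk>convex_subgroup H; f \<in> P; g \<in> H; inv f \<otimes> g \<in> P\<rbrakk> \<Longrightarrow> f \<in> H"
  unfolding convex_subgroup_def using P_carrier[of f] by (auto simp: lt_def)

lemma convex_carrier: "convex_subgroup (carrier G)"
  by (simp add: convex_subgroup_def subgroup_self)

lemma convex_Inter:
  assumes "\<H> \<noteq> {}" "\<And>H. H \<in> \<H> \<Longrightarrow> convex_subgroup H"
  shows "convex_subgroup (\<Inter>\<H>)"
  using assms unfolding convex_subgroup_def by (blast intro: subgroups_Inter)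

lemma restrict_left_cone:
  assumes "subgroup H G"
  shows "left_cone (G\<lparr>carrier := H\<rparr>) (P \<inter> H)"
  unfolding left_cone_subgroup_iff[OF assms]
  using one_notin_P P_mult P_cases subgroup.m_closed[OF assms] subgroup.m_inv_closed[OF assms]
    subgroup.mem_carrier[OF assms] by blast

lemma restrict_dense_cone:
  assumes H: "convex_subgroup H" and dense: "dense_cone G P"
  shows "dense_cone (G\<lparr>carrier := H\<rparr>) (P \<inter> H)"
proof -
  have sub: "subgroup H G" using H by (simp add: convex_subgroup_def)
  have "\<exists>f\<in>P \<inter> H. inv f \<otimes> g \<in> P \<inter> H" if g: "g \<in> P \<inter> H" for g
  proof -
    obtain f where f: "f \<in> P" "inv f \<otimes> g \<in> P" using dense g by (auto simp: dense_cone_def)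
    then have "f \<in> H" using convex_subgroupD[OF H] g by blast
    then have "inv f \<otimes> g \<in> H"
      using g subgroup.m_closed[OF sub subgroup.m_inv_closed[OF sub]] by blast
    then show ?thesis using f \<open>f \<in> H\<close> by blast
  qed
  then show ?thesis
    unfolding dense_cone_subgroup_iff[OF sub] using restrict_left_cone[OF sub] by blast
qed

text \<open>Elements outside a convex subgroup \<open>H\<close> lie on one side of all of \<open>H\<close>, so multiplying them by
members of \<open>H\<close> on either side does not change their sign. The order on the cosets and the order
on \<open>H\<close> are therefore independent.\<close>

lemma replace_left_cone:
  assumes H: "convex_subgroup H" and R: "left_cone (G\<lparr>carrier := H\<rparr>) R"
  shows "left_cone G ((P - H) \<union> R)"
proof -
  have sub: "subgroup H G" using H by (simp add: convex_subgroup_def)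
  note Hc = subgroup.mem_carrier[OF sub] and Hm = subgroup.m_closed[OF sub]
    and Hi = subgroup.m_inv_closed[OF sub]
  have RH: "R \<subseteq> H" and R1: "\<one> \<notin> R" and Rm: "\<And>x y. \<lbrakk>x \<in> R; y \<in> R\<rbrakk> \<Longrightarrow> x \<otimes> y \<in> R"
    and Rc: "\<And>x. x \<in> H \<Longrightarrow> x = \<one> \<or> x \<in> R \<or> inv x \<in> R"
    using R unfolding left_cone_subgroup_iff[OF sub] by auto
  have Hcancel_right: "x \<in> H" if "x \<in> carrier G" "y \<in> H" "x \<otimes> y \<in> H" for x y
    using Hm[OF that(3) Hi[OF that(2)]] that Hc by (simp add: m_assoc)
  have Hcancel_left: "y \<in> H" if "y \<in> carrier G" "x \<in> H" "x \<otimes> y \<in> H" for x y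
    using Hm[OF Hi[OF that(2)] that(3)] that Hc by (simp add: group_normalize)
  have PP: "x \<otimes> y \<in> P - H" if x: "x \<in> P - H" and y: "y \<in> P" for x y
  proof
    show "x \<otimes> y \<in> P" using x y P_mult by blast
    show "x \<otimes> y \<notin> H"
    proof
      assume "x \<otimes> y \<in> H"
      moreover have "inv x \<otimes> (x \<otimes> y) \<in> P" using x y P_carrier by (simp add: group_normalize)
      ultimately show False using convex_subgroupD[OF H] x by blast
    qed
  qed
  have PH: "x \<otimes> y \<in> P - H" if x: "x \<in> P - H" and y: "y \<in> H" for x y
  proof
    have xc: "x \<in> carrier G" and yc: "y \<in> carrier G" using x y P_carrier Hc by auto
    show nH: "x \<otimes> y \<notin> H" using Hcancel_right xc x y by blast
    show "x \<otimes> y \<in> P"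
    proof (rule ccontr)
      assume "x \<otimes> y \<notin> P"
      then have z: "inv (x \<otimes> y) \<in> P" using P_cases[of "x \<otimes> y"] nH subgroup.one_closed[OF sub] xc yc by auto
      moreover have "inv (inv (x \<otimes> y)) \<otimes> inv y \<in> P" using xc yc x by (simp add: m_assoc)
      ultimately have "inv (x \<otimes> y) \<in> H" using convex_subgroupD[OF H] Hi[OF y] by blast
      then show False using Hi[of "inv (x \<otimes> y)"] nH xc yc by simp
    qed
  qed
  have HP: "x \<otimes> y \<in> P - H" if x: "x \<in> H" and y: "y \<in> P - H" for x y
  proof
    have xc: "x \<in> carrier G" and yc: "y \<in> carrier G" using x y P_carrier Hc by auto
    show nH: "x \<otimes> y \<notin> H" using Hcancel_left yc x y by blast
    show "x \<otimes> y \<in> P"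
    proof (rule ccontr)
      assume "x \<otimes> y \<notin> P"
      then have z: "inv (x \<otimes> y) \<in> P" using P_cases[of "x \<otimes> y"] nH subgroup.one_closed[OF sub] xc yc by auto
      have "inv y \<otimes> inv x = inv (x \<otimes> y)" using xc yc by (simp add: inv_mult_group)
      then have "y \<in> H" using convex_subgroupD[OF H, of y "inv x"] Hi[OF x] y z by auto
      then show False using y by blast
    qed
  qed
  show ?thesis
    unfolding left_cone_def
  proof (intro conjI ballI)
    show "P - H \<union> R \<subseteq> carrier G" using P_carrier RH Hc by blast
    show "\<one> \<notin> P - H \<union> R" using one_notin_P R1 by blast
    show "x \<otimes> y \<in> P - H \<union> R" if "x \<in> P - H \<union> R" "y \<in> P - H \<union> R" for x y
      using that PP[of x y] PH[of x y] HP[of x y] Rm[of x y] RH by auto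
    show "x = \<one> \<or> x \<in> P - H \<union> R \<or> inv x \<in> P - H \<union> R" if x: "x \<in> carrier G" for x
    proof (cases "x \<in> H")
      case False
      then have "inv x \<notin> H" using Hi[of "inv x"] x by auto
      then show ?thesis using False P_cases[OF x] by blast
    qed (use Rc in blast)
  qed
qed

text \<open>A positive element outside \<open>H\<close> exceeds all of \<open>H\<close>, so any member of \<open>R\<close> lies
strictly below it. Hence density is only at stake inside \<open>H\<close>.\<close>

lemma replace_dense_cone:
  assumes H: "convex_subgroup H" and R: "dense_cone (G\<lparr>carrier := H\<rparr>) R" and ne: "R \<noteq> {}"
  shows "dense_cone G ((P - H) \<union> R)"
proof -
  have sub: "subgroup H G" using H by (simp add: convex_subgroup_def)
  have lR: "left_cone (G\<lparr>carrier := H\<rparr>) R" and dR: "\<And>g. g \<in> R \<Longrightarrow> \<exists>f\<in>R. inv f \<otimes> g \<in> R"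
    using R unfolding dense_cone_subgroup_iff[OF sub] by auto
  have RH: "R \<subseteq> H" using lR unfolding left_cone_subgroup_iff[OF sub] by auto
  have "\<exists>f\<in>P - H \<union> R. inv f \<otimes> g \<in> P - H \<union> R" if g: "g \<in> P - H \<union> R" for g
  proof (cases "g \<in> R")
    case True
    then show ?thesis using dR by blast
  next
    case False
    then have g: "g \<in> P" "g \<notin> H" using that by auto
    obtain f where f: "f \<in> R" using ne by blast
    then have fH: "f \<in> H" using RH by blast
    then have c: "f \<in> carrier G" "g \<in> carrier G" using subgroup.mem_carrier[OF sub] P_carrier g by auto
    have "inv f \<otimes> g \<notin> H"
    proof
      assume "inv f \<otimes> g \<in> H"
      then have "f \<otimes> (inv f \<otimes> g) \<in> H" using fH subgroup.m_closed[OF sub] by blast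
      then show False using g c by (simp add: group_normalize)
    qed
    moreover have "inv f \<otimes> g \<in> P"
    proof (rule ccontr)
      assume "inv f \<otimes> g \<notin> P"
      then have "inv (inv f \<otimes> g) \<in> P"
        using P_cases[of "inv f \<otimes> g"] c \<open>inv f \<otimes> g \<notin> H\<close> subgroup.one_closed[OF sub] by auto
      then have "inv g \<otimes> f \<in> P" using c by (simp add: inv_mult_group)
      then show False using convex_subgroupD[OF H g(1) fH] g by blast
    qed
    ultimately show ?thesis using f by blast
  qed
  then show ?thesis unfolding dense_cone_def using replace_left_cone[OF H lR] by blast
qed

text \<open>Reversing an order preserves density, so a nontrivial convex subgroup that contains none of the
elements of \<open>F\<close> gives a second dense cone containing \<open>F\<close>.\<close>

lemma flip_convex_subgroup:
  assumes H: "convex_subgroup H" "H \<noteq> {\<one>}" and dense: "dense_cone G P"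
    and F: "F \<subseteq> P" "F \<inter> H = {}"
  shows "\<exists>Q. dense_cone G Q \<and> F \<subseteq> Q \<and> Q \<noteq> P"
proof -
  have sub: "subgroup H G" using H by (simp add: convex_subgroup_def)
  note Hc = subgroup.mem_carrier[OF sub] and Hm = subgroup.m_closed[OF sub]
    and Hi = subgroup.m_inv_closed[OF sub]
  define R where "R = {x \<in> H. inv x \<in> P}"
  have lR: "left_cone (G\<lparr>carrier := H\<rparr>) R"
    unfolding left_cone_subgroup_iff[OF sub]
  proof (intro conjI ballI)
    show "R \<subseteq> H" by (auto simp: R_def)
    show "\<one> \<notin> R" by (simp add: R_def one_notin_P)
    show "x \<otimes> y \<in> R" if "x \<in> R" "y \<in> R" for x y
      using that P_mult Hm Hc by (simp add: R_def inv_mult_group)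
    show "x = \<one> \<or> x \<in> R \<or> inv x \<in> R" if "x \<in> H" for x
      using that P_cases[of x] Hc[of x] Hi[of x] by (auto simp: R_def)
  qed
  have dR: "\<exists>f\<in>R. inv f \<otimes> g \<in> R" if g: "g \<in> R" for g
  proof -
    have gc: "g \<in> carrier G" "g \<in> H" "inv g \<in> P" using g Hc by (auto simp: R_def)
    obtain f where f: "f \<in> P" "inv f \<otimes> inv g \<in> P" using dense gc by (auto simp: dense_cone_def)
    then have fH: "f \<in> H" using convex_subgroupD[OF H(1) f(1) Hi[OF gc(2)]] by blast
    have fc: "f \<in> carrier G" using f P_carrier by blast
    have "g \<otimes> f \<in> R"
      using f gc fc fH Hm by (simp add: R_def inv_mult_group)
    moreover have "inv (g \<otimes> f) \<otimes> g \<in> R"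
    proof -
      have "inv (inv (g \<otimes> f) \<otimes> g) = inv g \<otimes> (g \<otimes> f)" using gc fc by (simp add: inv_mult_group)
      also have "\<dots> = f" using gc fc by (simp add: group_normalize)
      finally show ?thesis using f gc fH Hm Hi by (simp add: R_def)
    qed
    ultimately show ?thesis by blast
  qed
  obtain h where h: "h \<in> H" "h \<noteq> \<one>" using H(2) subgroup.one_closed[OF sub] by blast
  then have "h \<in> P \<or> inv h \<in> P" using P_cases Hc by blast
  then obtain k where k: "k \<in> H" "k \<in> P" using h Hi by blast
  then have "inv k \<in> R" using Hi Hc by (simp add: R_def)
  then have ne: "R \<noteq> {}" by blast
  have "dense_cone G ((P - H) \<union> R)"
    using lR dR ne by (intro replace_dense_cone H) (simp_all add: dense_cone_subgroup_iff[OF sub])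
  moreover have "F \<subseteq> (P - H) \<union> R" using F by blast
  moreover have "k \<notin> (P - H) \<union> R" using k P_inv by (simp add: R_def)
  ultimately show ?thesis using k by blast
qed

section \<open>Conjugate orderings\<close>

text \<open>The stabilizer of the cone under conjugation. For \<open>g\<close> in this set the order is invariant
under right multiplication by \<open>g\<close>.\<close>

definition right_invariant :: "'a set" where
  "right_invariant = {g \<in> carrier G. \<forall>x\<in>carrier G. inv g \<otimes> x \<otimes> g \<in> P \<longleftrightarrow> x \<in> P}"

text \<open>Conjugation is an automorphism, so it carries dense cones to dense cones.\<close>

lemma conj_dense_cone:
  assumes "dense_cone G P" "g \<in> carrier G"
  shows "dense_cone G {x \<in> carrier G. inv g \<otimes> x \<otimes> g \<in> P}"
proof -
  have conj_mult: "inv g \<otimes> (x \<otimes> y) \<otimes> g = (inv g \<otimes> x \<otimes> g) \<otimes> (inv g \<otimes> y \<otimes> g)"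
    if "x \<in> carrier G" "y \<in> carrier G" for x y
    using that assms(2) by (simp add: group_normalize)
  have conj_inv: "inv g \<otimes> inv x \<otimes> g = inv (inv g \<otimes> x \<otimes> g)" if "x \<in> carrier G" for x
    using that assms(2) by (simp add: group_normalize)
  have conj_one: "inv g \<otimes> x \<otimes> g = \<one> \<longleftrightarrow> x = \<one>" if "x \<in> carrier G" for x
  proof
    assume "inv g \<otimes> x \<otimes> g = \<one>"
    then have "g \<otimes> (inv g \<otimes> x \<otimes> g) \<otimes> inv g = g \<otimes> \<one> \<otimes> inv g" by simp
    then show "x = \<one>" using that assms(2) by (simp add: group_normalize)
  qed (use assms(2) in simp)
  show ?thesis
    unfolding dense_cone_def left_cone_def
  proof (intro conjI ballI)
    show "\<one> \<notin> {x \<in> carrier G. inv g \<otimes> x \<otimes> g \<in> P}" using assms(2) one_notin_P by simp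
    show "x \<otimes> y \<in> {x \<in> carrier G. inv g \<otimes> x \<otimes> g \<in> P}"
      if "x \<in> {x \<in> carrier G. inv g \<otimes> x \<otimes> g \<in> P}" "y \<in> {x \<in> carrier G. inv g \<otimes> x \<otimes> g \<in> P}" for x y
      using that conj_mult P_mult by simp
    show "x = \<one> \<or> x \<in> {x \<in> carrier G. inv g \<otimes> x \<otimes> g \<in> P} \<or> inv x \<in> {x \<in> carrier G. inv g \<otimes> x \<otimes> g \<in> P}"
      if "x \<in> carrier G" for x
      using that P_cases[of "inv g \<otimes> x \<otimes> g"] conj_inv[OF that] conj_one[OF that] assms(2) by auto
    show "\<exists>f\<in>{x \<in> carrier G. inv g \<otimes> x \<otimes> g \<in> P}. inv f \<otimes> h \<in> {x \<in> carrier G. inv g \<otimes> x \<otimes> g \<in> P}"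
      if "h \<in> {x \<in> carrier G. inv g \<otimes> x \<otimes> g \<in> P}" for h
    proof -
      have h: "h \<in> carrier G" "inv g \<otimes> h \<otimes> g \<in> P" using that by auto
      then obtain f where f: "f \<in> P" "inv f \<otimes> (inv g \<otimes> h \<otimes> g) \<in> P"
        using assms(1) by (auto simp: dense_cone_def)
      have fc: "f \<in> carrier G" using f P_carrier by blast
      let ?f = "g \<otimes> f \<otimes> inv g"
      have conj_f: "inv g \<otimes> ?f \<otimes> g = f"
        using fc assms(2) by (simp add: group_normalize)
      have "inv g \<otimes> (inv ?f \<otimes> h) \<otimes> g = inv (inv g \<otimes> ?f \<otimes> g) \<otimes> (inv g \<otimes> h \<otimes> g)"
        using conj_mult[of "inv ?f" h] conj_inv[of ?f] fc assms(2) h by simp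
      then have "inv g \<otimes> (inv ?f \<otimes> h) \<otimes> g \<in> P" using f conj_f by simp
      then show ?thesis using f fc assms(2) h conj_f by (intro bexI[of _ ?f]) simp_all
    qed
  qed auto
qed

lemma right_invariant_subgroup: "subgroup right_invariant G"
proof (rule subgroupI)
  show "right_invariant \<subseteq> carrier G" by (auto simp: right_invariant_def)
  have "\<one> \<in> right_invariant" by (simp add: right_invariant_def)
  then show "right_invariant \<noteq> {}" by blast
next
  fix g assume g: "g \<in> right_invariant"
  then have gc: "g \<in> carrier G" and inv: "\<And>x. x \<in> carrier G \<Longrightarrow> inv g \<otimes> x \<otimes> g \<in> P \<longleftrightarrow> x \<in> P"
    by (auto simp: right_invariant_def)
  have "g \<otimes> x \<otimes> inv g \<in> P \<longleftrightarrow> x \<in> P" if "x \<in> carrier G" for x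
  proof -
    have "inv g \<otimes> (g \<otimes> x \<otimes> inv g) \<otimes> g = x"
      using that gc by (simp add: group_normalize)
    then show ?thesis using inv[of "g \<otimes> x \<otimes> inv g"] that gc by simp
  qed
  then show "inv g \<in> right_invariant" using gc by (simp add: right_invariant_def)
next
  fix g h assume "g \<in> right_invariant" "h \<in> right_invariant"
  then have c: "g \<in> carrier G" "h \<in> carrier G"
    and inv: "\<And>x. x \<in> carrier G \<Longrightarrow> inv g \<otimes> x \<otimes> g \<in> P \<longleftrightarrow> x \<in> P"
      "\<And>x. x \<in> carrier G \<Longrightarrow> inv h \<otimes> x \<otimes> h \<in> P \<longleftrightarrow> x \<in> P"
    by (auto simp: right_invariant_def)
  have "inv (g \<otimes> h) \<otimes> x \<otimes> (g \<otimes> h) = inv h \<otimes> (inv g \<otimes> x \<otimes> g) \<otimes> h" if "x \<in> carrier G" for x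
    using that c by (simp add: group_normalize)
  then show "g \<otimes> h \<in> right_invariant" using c inv by (simp add: right_invariant_def)
qed

lemma lt_mult_right:
  assumes "a \<in> right_invariant" "x \<in> carrier G" "y \<in> carrier G"
  shows "x \<otimes> a <\<^sub>P y \<otimes> a \<longleftrightarrow> x <\<^sub>P y"
proof -
  have a: "a \<in> carrier G" using assms by (simp add: right_invariant_def)
  have "inv (x \<otimes> a) \<otimes> (y \<otimes> a) = inv a \<otimes> (inv x \<otimes> y) \<otimes> a"
    using a assms by (simp add: group_normalize)
  then show ?thesis using assms by (simp add: lt_def right_invariant_def)
qed

lemma le_mult_right:
  assumes "a \<in> right_invariant" "x \<in> carrier G" "y \<in> carrier G"
  shows "x \<otimes> a \<le>\<^sub>P y \<otimes> a \<longleftrightarrow> x \<le>\<^sub>P y"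
proof -
  have "a \<in> carrier G" using assms by (simp add: right_invariant_def)
  then show ?thesis using assms lt_mult_right[OF assms] by (simp add: le_def)
qed

lemma nat_pow_right_invariant: "a \<in> right_invariant \<Longrightarrow> a [^] (n::nat) \<in> right_invariant"
  using subgroup.m_closed[OF right_invariant_subgroup] subgroup.one_closed[OF right_invariant_subgroup]
  by (induction n) auto

text \<open>For a general left ordering the elements bounded by powers of \<open>a\<close> are not closed under
products. They are when right multiplication by \<open>a\<close> preserves the order, since then
\<open>x \<le> a\<^sup>m\<close> and \<open>y \<le> a\<^sup>n\<close> give \<open>x y \<le> x a\<^sup>n \<le> a\<^sup>m a\<^sup>n\<close>.\<close>

lemma convex_subgroup_of_powers:
  assumes a: "a \<in> right_invariant" "a \<in> P"
  shows "convex_subgroup {g \<in> carrier G. \<exists>n::nat. inv (a [^] n) \<le>\<^sub>P g \<and> g \<le>\<^sub>P a [^] n}"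
    (is "convex_subgroup ?B")
proof -
  have ac: "a \<in> carrier G" using a P_carrier by blast
  have ri: "a [^] n \<in> right_invariant" for n :: nat by (rule nat_pow_right_invariant[OF a(1)])
  have pc: "a [^] n \<in> carrier G" for n :: nat using ac by simp
  have upper_inv: "inv x \<le>\<^sub>P a [^] n \<longleftrightarrow> inv (a [^] n) \<le>\<^sub>P x" if "x \<in> carrier G" for x and n :: nat
  proof -
    have "inv (a [^] n) \<le>\<^sub>P x \<longleftrightarrow> inv (a [^] n) \<otimes> a [^] n \<le>\<^sub>P x \<otimes> a [^] n"
      using le_mult_right[OF ri, of "inv (a [^] n)" x n] that pc by simp
    also have "\<dots> \<longleftrightarrow> inv x \<otimes> \<one> \<le>\<^sub>P inv x \<otimes> (x \<otimes> a [^] n)"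
      using le_mult_left[of "inv x" \<one> "x \<otimes> a [^] n"] that pc by simp
    also have "\<dots> \<longleftrightarrow> inv x \<le>\<^sub>P a [^] n" using that pc by (simp add: group_normalize)
    finally show ?thesis by blast
  qed
  have mult_le: "x \<otimes> y \<le>\<^sub>P a [^] (m + n)"
    if "x \<le>\<^sub>P a [^] m" "y \<le>\<^sub>P a [^] n" "x \<in> carrier G" "y \<in> carrier G" for x y and m n :: nat
  proof -
    have "x \<otimes> y \<le>\<^sub>P x \<otimes> a [^] n" using that pc le_mult_left by simp
    moreover have "x \<otimes> a [^] n \<le>\<^sub>P a [^] m \<otimes> a [^] n" using that pc le_mult_right[OF ri] by simp
    ultimately show ?thesis using le_trans that pc ac by (metis m_closed nat_pow_mult)
  qed
  have B: "x \<in> ?B \<longleftrightarrow> x \<in> carrier G \<and> (\<exists>n::nat. inv x \<le>\<^sub>P a [^] n \<and> x \<le>\<^sub>P a [^] n)" for x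
    using upper_inv by auto
  have mono: "a [^] m \<le>\<^sub>P a [^] (m + n)" for m n :: nat
  proof (induction n)
    case 0
    show ?case by (simp add: le_refl)
  next
    case (Suc n)
    have "a [^] (m + n) \<otimes> \<one> <\<^sub>P a [^] (m + n) \<otimes> a"
      using a ac lt_mult_left[of "a [^] (m + n)" \<one> a] by (simp add: one_lt_iff)
    then have "a [^] (m + n) <\<^sub>P a [^] (m + Suc n)" using ac by simp
    then show ?case using Suc le_trans pc le_def by blast
  qed
  have le_pow_add: "x \<le>\<^sub>P a [^] (m + n)" "x \<le>\<^sub>P a [^] (n + m)"
    if "x \<le>\<^sub>P a [^] m" "x \<in> carrier G" for x and m n :: nat
    using le_trans[OF that(1) mono that(2) pc pc, of n] by (simp_all add: add.commute)
  have one_B: "\<one> \<in> ?B" unfolding B using le_refl[of \<one>] by (auto intro!: exI[of _ 0])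
  show ?thesis
    unfolding convex_subgroup_def
  proof (intro conjI ballI impI)
    show "subgroup ?B G"
    proof (rule subgroupI)
      fix x y assume "x \<in> ?B" "y \<in> ?B"
      then obtain m n :: nat where mn: "inv x \<le>\<^sub>P a [^] m" "x \<le>\<^sub>P a [^] m" "inv y \<le>\<^sub>P a [^] n" "y \<le>\<^sub>P a [^] n"
        and c: "x \<in> carrier G" "y \<in> carrier G" unfolding B by blast
      have "x \<otimes> y \<le>\<^sub>P a [^] (m + n)" by (rule mult_le[OF mn(2,4) c])
      moreover have "inv (x \<otimes> y) \<le>\<^sub>P a [^] (m + n)"
        using mult_le[OF mn(3,1)] c by (simp add: inv_mult_group add.commute)
      ultimately show "x \<otimes> y \<in> ?B" unfolding B using c by blast
    next
      fix x assume "x \<in> ?B"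
      then show "inv x \<in> ?B" unfolding B by auto
    qed (use one_B in auto)
  next
    fix f g assume f: "f \<in> carrier G" "\<one> <\<^sub>P f" and g: "g \<in> ?B" "f <\<^sub>P g"
    then obtain n :: nat where n: "g \<le>\<^sub>P a [^] n" and gc: "g \<in> carrier G" unfolding B by blast
    have "f \<le>\<^sub>P a [^] n" using le_trans[of f g "a [^] n"] n g f gc pc by (simp add: le_def)
    moreover have "inv f <\<^sub>P \<one>"
      using lt_mult_left[of "inv f" \<one> f] f by simp
    then have "inv f \<le>\<^sub>P a [^] (0::nat)" by (simp add: le_def)
    then have "inv f \<le>\<^sub>P a [^] n" using le_pow_add(2)[of "inv f" 0 n] f by simp
    ultimately show "f \<in> ?B" unfolding B using f by blast
  qed
qed

text \<open>Conjugating by a positive element \<open>g\<close> below every member of \<open>F\<close> keeps \<open>F\<close> positive, so if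
no other dense cone contains \<open>F\<close>, all such \<open>g\<close> stabilize the cone. An element below
\<open>a\<^sup>n\<close> is a product of \<open>n\<close> elements of this kind, and in the absence of proper convex
subgroups the powers of \<open>a\<close> bound every element.\<close>

lemma right_invariant_of_isolated:
  assumes dense: "dense_cone G P"
    and F: "finite F" "F \<noteq> {}" "F \<subseteq> P"
    and isolated: "\<And>Q. \<lbrakk>dense_cone G Q; F \<subseteq> Q\<rbrakk> \<Longrightarrow> Q = P"
    and simple: "\<And>H. convex_subgroup H \<Longrightarrow> H = {\<one>} \<or> H = carrier G"
  shows "right_invariant = carrier G"
proof -
  note Nm = subgroup.m_closed[OF right_invariant_subgroup]
    and Ni = subgroup.m_inv_closed[OF right_invariant_subgroup]
  have Fc: "F \<subseteq> carrier G" using F P_carrier by blast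
  obtain a where a: "a \<in> F" and least: "\<And>f. f \<in> F \<Longrightarrow> a \<le>\<^sub>P f"
    using finite_has_least[OF F(1,2) Fc] by blast
  have aP: "a \<in> P" and ac: "a \<in> carrier G" using a F Fc by auto
  \<comment> \<open>\<open>g \<le> f < f g\<close> says that \<open>g\<^sup>-\<^sup>1 f g\<close> is positive\<close>
  have interval: "g \<in> right_invariant" if g: "g \<in> P" "g \<le>\<^sub>P a" for g
  proof -
    have gc: "g \<in> carrier G" using g P_carrier by blast
    have "inv g \<otimes> f \<otimes> g \<in> P" if f: "f \<in> F" for f
    proof -
      have fc: "f \<in> carrier G" using f Fc by blast
      have "g \<le>\<^sub>P f" using le_trans[OF g(2) least[OF f]] gc ac fc by blast
      moreover have "f \<otimes> \<one> <\<^sub>P f \<otimes> g" using lt_mult_left[of f \<one> g] fc gc g by (simp add: one_lt_iff)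
      ultimately have "g <\<^sub>P f \<otimes> g" using le_lt_trans[of g f "f \<otimes> g"] fc gc by simp
      then show ?thesis using gc fc by (simp add: lt_def m_assoc)
    qed
    then have "{x \<in> carrier G. inv g \<otimes> x \<otimes> g \<in> P} = P"
      using Fc by (intro isolated conj_dense_cone dense gc) auto
    then show ?thesis using gc by (auto simp: right_invariant_def)
  qed
  then have aN: "a \<in> right_invariant" using aP le_refl by blast
  have powers: "g \<in> right_invariant" if "g \<in> P" "g \<le>\<^sub>P a [^] (n::nat)" for g n
    using that
  proof (induction n arbitrary: g)
    case 0
    then have "g \<in> carrier G" "g \<le>\<^sub>P \<one>" using P_carrier by auto
    moreover have "\<one> <\<^sub>P g" using 0 one_lt_iff P_carrier by blast
    ultimately have False using lt_le_trans[of \<one> g \<one>] lt_irrefl by blast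
    then show ?case ..
  next
    case (Suc n)
    have gc: "g \<in> carrier G" using Suc P_carrier by blast
    show ?case
    proof (cases "g \<le>\<^sub>P a")
      case True
      then show ?thesis using interval Suc by blast
    next
      case False
      then have "a <\<^sub>P g" using not_le gc ac by blast
      then have "inv a \<otimes> g \<in> P" by (simp add: lt_def)
      moreover have "g \<le>\<^sub>P a \<otimes> a [^] n"
        using Suc.prems(2) by (simp only: nat_pow_Suc2[OF ac])
      then have "inv a \<otimes> g \<le>\<^sub>P inv a \<otimes> (a \<otimes> a [^] n)" using le_mult_left[of "inv a" g] ac gc by simp
      then have "inv a \<otimes> g \<le>\<^sub>P a [^] n" using ac by (simp add: group_normalize)
      ultimately have "inv a \<otimes> g \<in> right_invariant" by (rule Suc.IH)
      then have "a \<otimes> (inv a \<otimes> g) \<in> right_invariant" using aN Nm by blast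
      then show ?thesis using ac gc by (simp add: group_normalize)
    qed
  qed
  let ?B = "{g \<in> carrier G. \<exists>n::nat. inv (a [^] n) \<le>\<^sub>P g \<and> g \<le>\<^sub>P a [^] n}"
  have B: "convex_subgroup ?B" by (rule convex_subgroup_of_powers[OF aN aP])
  then have subB: "subgroup ?B G" by (simp add: convex_subgroup_def)
  have "inv a <\<^sub>P a"
  proof -
    have "inv a <\<^sub>P \<one>" using lt_mult_left[of "inv a" \<one> a] ac aP by (simp add: one_lt_iff)
    moreover have "\<one> <\<^sub>P a" using ac aP by (simp add: one_lt_iff)
    ultimately show ?thesis using lt_trans ac by blast
  qed
  then have "a \<in> ?B" using ac by (auto simp: le_def intro!: exI[of _ 1])
  moreover have "a \<noteq> \<one>" using aP one_notin_P by blast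
  ultimately have BG: "?B = carrier G" using simple[OF B] by blast
  have PN: "g \<in> right_invariant" if "g \<in> P" for g
    using powers that BG P_carrier by blast
  show ?thesis
  proof
    show "carrier G \<subseteq> right_invariant"
    proof
      fix g assume g: "g \<in> carrier G"
      consider "g = \<one>" | "g \<in> P" | "inv g \<in> P" using P_cases[OF g] by blast
      then show "g \<in> right_invariant"
      proof cases
        case 1
        then show ?thesis using subgroup.one_closed[OF right_invariant_subgroup] by simp
      next
        case 2
        then show ?thesis by (rule PN)
      next
        case 3
        then show ?thesis using Ni[OF PN[OF 3]] g by simp
      qed
    qed
  qed (auto simp: right_invariant_def)
qed

end

section \<open>Archimedean bi-orderings and Hoelder's theorem\<close>

locale archimedean_ordered_group = left_ordered_group +
  assumes bi_invariant: "right_invariant = carrier G"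
    and archimedean: "\<lbrakk>a \<in> P; g \<in> carrier G\<rbrakk> \<Longrightarrow> \<exists>n::int. g \<le>\<^sub>P a [^] n"
begin

lemma lt_right: "\<lbrakk>a \<in> carrier G; x \<in> carrier G; y \<in> carrier G\<rbrakk> \<Longrightarrow> x \<otimes> a <\<^sub>P y \<otimes> a \<longleftrightarrow> x <\<^sub>P y"
  using lt_mult_right bi_invariant by simp

lemma le_right: "\<lbrakk>a \<in> carrier G; x \<in> carrier G; y \<in> carrier G\<rbrakk> \<Longrightarrow> x \<otimes> a \<le>\<^sub>P y \<otimes> a \<longleftrightarrow> x \<le>\<^sub>P y"
  using le_mult_right bi_invariant by simp

lemma mult_mono_le:
  assumes "x \<le>\<^sub>P x'" "y \<le>\<^sub>P y'" and c: "x \<in> carrier G" "x' \<in> carrier G" "y \<in> carrier G" "y' \<in> carrier G"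
  shows "x \<otimes> y \<le>\<^sub>P x' \<otimes> y'"
proof (rule le_trans)
  show "x \<otimes> y \<le>\<^sub>P x' \<otimes> y" using assms le_right by blast
  show "x' \<otimes> y \<le>\<^sub>P x' \<otimes> y'" using assms le_mult_left by blast
qed (use c in auto)

lemma mult_mono_lt:
  assumes "x <\<^sub>P x'" "y <\<^sub>P y'" and c: "x \<in> carrier G" "x' \<in> carrier G" "y \<in> carrier G" "y' \<in> carrier G"
  shows "x \<otimes> y <\<^sub>P x' \<otimes> y'"
proof (rule lt_trans)
  show "x \<otimes> y <\<^sub>P x' \<otimes> y" using assms lt_right by blast
  show "x' \<otimes> y <\<^sub>P x' \<otimes> y'" using assms lt_mult_left by blast
qed (use c in auto)

lemma int_pow_in_P:
  assumes "a \<in> P" "0 < k"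
  shows "a [^] (k::int) \<in> P"
  using assms(2)
proof (induction k rule: int_gr_induct)
  case base
  then show ?case using P_carrier[OF assms(1)] assms(1) by simp
next
  case (step i)
  then show ?case using P_mult[OF _ assms(1)] P_carrier[OF assms(1)] by (simp add: int_pow_mult)
qed

lemma int_pow_in_P_iff:
  assumes "a \<in> P"
  shows "a [^] (k::int) \<in> P \<longleftrightarrow> 0 < k"
proof
  assume k: "a [^] k \<in> P"
  show "0 < k"
  proof (rule ccontr)
    assume "\<not> 0 < k"
    then consider "k = 0" | "0 < - k" by linarith
    then show False
    proof cases
      case 1
      then show False using k one_notin_P by simp
    next
      case 2
      then have "a [^] (- k) \<in> P" using int_pow_in_P assms by blast
      then show False using k P_inv P_carrier[OF assms] by (simp add: int_pow_neg)
    qed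
  qed
qed (use assms int_pow_in_P in blast)

lemma int_pow_lt_iff: "a \<in> P \<Longrightarrow> a [^] (m::int) <\<^sub>P a [^] (n::int) \<longleftrightarrow> m < n"
  using int_pow_in_P_iff[of a "n - m"] P_carrier[of a] int_pow_mult[of a "- m" n]
  by (simp add: lt_def int_pow_neg)

lemma int_pow_le_iff: "a \<in> P \<Longrightarrow> a [^] (m::int) \<le>\<^sub>P a [^] (n::int) \<longleftrightarrow> m \<le> n"
  using int_pow_lt_iff[of a n m] not_lt[of "a [^] n" "a [^] m"] P_carrier[of a] by auto

lemma le_int_pow_mono:
  assumes "x \<le>\<^sub>P y" "x \<in> carrier G" "y \<in> carrier G" "0 < n"
  shows "x [^] (n::int) \<le>\<^sub>P y [^] n"
  using assms(4)
proof (induction n rule: int_gr_induct)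
  case base
  then show ?case using assms by simp
next
  case (step i)
  then show ?case using assms mult_mono_le by (simp add: int_pow_mult)
qed

lemma archimedean_below:
  assumes "a \<in> P" "g \<in> carrier G"
  shows "\<exists>n::int. a [^] n \<le>\<^sub>P g"
proof -
  obtain n :: int where n: "inv g \<le>\<^sub>P a [^] n" using archimedean[OF assms(1)] assms by blast
  have ac: "a \<in> carrier G" using assms P_carrier by blast
  have "\<one> \<le>\<^sub>P g \<otimes> a [^] n"
    using le_mult_left[of g "inv g" "a [^] n"] n ac assms by simp
  then have "a [^] (- n) \<le>\<^sub>P g \<otimes> a [^] n \<otimes> a [^] (- n)"
    using le_right[of "a [^] (- n)" \<one> "g \<otimes> a [^] n"] ac assms by simp
  moreover have "g \<otimes> a [^] n \<otimes> a [^] (- n) = g" using ac assms by (simp add: m_assoc int_pow_neg)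
  ultimately have "a [^] (- n) \<le>\<^sub>P g" by simp
  then show ?thesis by blast
qed

lemma int_floor:
  assumes a: "a \<in> P" and x: "x \<in> carrier G"
  shows "\<exists>m::int. a [^] m \<le>\<^sub>P x \<and> x <\<^sub>P a [^] (m + 1)"
proof (rule ccontr)
  assume no: "\<not> ?thesis"
  have ac: "a \<in> carrier G" using a P_carrier by blast
  have step: "a [^] (m + 1) \<le>\<^sub>P x" if "a [^] m \<le>\<^sub>P x" for m :: int
    using no that not_lt[of x "a [^] (m + 1)"] x ac by auto
  obtain l u :: int where l: "a [^] l \<le>\<^sub>P x" and u: "x \<le>\<^sub>P a [^] u"
    using archimedean archimedean_below a x by blast
  have all: "a [^] m \<le>\<^sub>P x" if "l \<le> m" for m
    using that by (induction m rule: int_ge_induct) (use l step in auto)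
  have "a [^] max l (u + 1) \<le>\<^sub>P a [^] u"
    using le_trans[OF all u] x ac by simp
  then show False using int_pow_le_iff[OF a] by simp
qed

text \<open>If \<open>1 < e < c\<close>, then \<open>c\<close> is the product of the positive elements \<open>e\<close> and \<open>e\<^sup>-\<^sup>1 c\<close>,
and the smaller of the two has its square below \<open>c\<close>.\<close>

lemma square_below:
  assumes dense: "dense_cone G P" and c: "c \<in> P"
  shows "\<exists>d\<in>P. d \<otimes> d \<le>\<^sub>P c"
proof -
  obtain e where e: "e \<in> P" "inv e \<otimes> c \<in> P" using dense c by (auto simp: dense_cone_def)
  define e' where "e' = inv e \<otimes> c"
  have carr: "e \<in> carrier G" "e' \<in> carrier G" "c \<in> carrier G" using e c P_carrier by (auto simp: e'_def)
  have ee': "e \<otimes> e' = c" using carr by (simp add: e'_def group_normalize)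
  show ?thesis
  proof (cases "e \<le>\<^sub>P e'")
    case True
    then have "e \<otimes> e \<le>\<^sub>P c" using le_mult_left[of e e e'] carr ee' by simp
    then show ?thesis using e by blast
  next
    case False
    then have "e' \<le>\<^sub>P e" using le_cases carr by blast
    then have "e' \<otimes> e' \<le>\<^sub>P c" using le_right[of e' e' e] carr ee' by simp
    then show ?thesis using e by (auto simp: e'_def)
  qed
qed

text \<open>Choose \<open>d > 1\<close> with \<open>d\<^sup>2\<close> at most the commutator. Locating \<open>x\<close> and \<open>y\<close> between
consecutive powers of \<open>d\<close> determines the order of magnitude of both \<open>x y\<close> and \<open>y x\<close> up to a
factor less than \<open>d\<^sup>2\<close>, so they cannot differ by the commutator.\<close>

lemma commutator_not_positive:
  assumes dense: "dense_cone G P" and x: "x \<in> carrier G" and y: "y \<in> carrier G"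
  shows "\<not> y \<otimes> x <\<^sub>P x \<otimes> y"
proof
  assume "y \<otimes> x <\<^sub>P x \<otimes> y"
  then have "inv (y \<otimes> x) \<otimes> (x \<otimes> y) \<in> P" by (simp add: lt_def)
  then obtain d where d: "d \<in> P" "d \<otimes> d \<le>\<^sub>P inv (y \<otimes> x) \<otimes> (x \<otimes> y)"
    using square_below[OF dense] by blast
  have dc: "d \<in> carrier G" using d P_carrier by blast
  obtain m n :: int where m: "d [^] m \<le>\<^sub>P x" "x <\<^sub>P d [^] (m + 1)"
    and n: "d [^] n \<le>\<^sub>P y" "y <\<^sub>P d [^] (n + 1)"
    using int_floor[OF d(1) x] int_floor[OF d(1) y] by blast
  have "d [^] n \<otimes> d [^] m \<otimes> (d \<otimes> d) \<le>\<^sub>P (y \<otimes> x) \<otimes> (inv (y \<otimes> x) \<otimes> (x \<otimes> y))"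
    by (rule mult_mono_le[OF mult_mono_le[OF n(1) m(1)] d(2)])
      (use x y dc in \<open>simp_all del: inv_mult_group\<close>)
  also have "d [^] n \<otimes> d [^] m \<otimes> (d \<otimes> d) = d [^] (n + m + 2)"
    using dc int_pow_mult[OF dc, of 1 1] by (simp add: m_assoc int_pow_mult)
  also have "(y \<otimes> x) \<otimes> (inv (y \<otimes> x) \<otimes> (x \<otimes> y)) = x \<otimes> y"
    using x y by (simp add: inv_cancel_left' del: inv_mult_group)
  finally have "d [^] (n + m + 2) \<le>\<^sub>P x \<otimes> y" .
  moreover have "x \<otimes> y <\<^sub>P d [^] (m + 1) \<otimes> d [^] (n + 1)"
    by (rule mult_mono_lt[OF m(2) n(2)]) (use x y dc in auto)
  ultimately have "d [^] (n + m + 2) <\<^sub>P d [^] (m + 1) \<otimes> d [^] (n + 1)"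
    by (rule le_lt_trans) (use x y dc in auto)
  also have "d [^] (m + 1) \<otimes> d [^] (n + 1) = d [^] ((m + 1) + (n + 1))"
    by (rule int_pow_mult[OF dc, symmetric])
  also have "(m + 1) + (n + 1) = n + m + 2" by simp
  finally show False using lt_irrefl dc by simp
qed

lemma commutative:
  assumes "dense_cone G P" "x \<in> carrier G" "y \<in> carrier G"
  shows "x \<otimes> y = y \<otimes> x"
  using commutator_not_positive[OF assms] commutator_not_positive[OF assms(1,3,2)]
    lt_total[of "x \<otimes> y" "y \<otimes> x"] assms by auto

text \<open>The lower Dedekind cut of the real number that measures \<open>g\<close> in units of \<open>a\<close>.\<close>

definition slope_cut :: "'a \<Rightarrow> 'a \<Rightarrow> real set" where
  "slope_cut a g = {of_int m / of_int n | m n. 0 < n \<and> a [^] (m::int) \<le>\<^sub>P g [^] (n::int)}"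

definition slope :: "'a \<Rightarrow> 'a \<Rightarrow> real" where
  "slope a g = Sup (slope_cut a g)"

text \<open>From \<open>a^m' \<le> g^n'\<close> and \<open>g^n \<le> a^m\<close> one gets \<open>a^(m' n) \<le> g^(n n') \<le> a^(m n')\<close>, so
fractions obtained as lower bounds never exceed those obtained as upper bounds.\<close>

lemma slope_cut_upper:
  assumes a: "a \<in> P" and g: "g \<in> carrier G" and s: "s \<in> slope_cut a g"
    and n: "0 < n" "g [^] n \<le>\<^sub>P a [^] (m::int)"
  shows "s \<le> of_int m / of_int n"
proof -
  have ac: "a \<in> carrier G" using a P_carrier by blast
  obtain m' n' where s: "s = of_int m' / of_int n'" and n': "0 < n'" "a [^] m' \<le>\<^sub>P g [^] n'"
    using s by (auto simp: slope_cut_def)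
  have "a [^] (m' * n) \<le>\<^sub>P g [^] (n' * n)"
    using le_int_pow_mono[OF n'(2) _ _ n(1)] ac g by (simp add: int_pow_pow)
  moreover have "g [^] (n' * n) \<le>\<^sub>P a [^] (m * n')"
    using le_int_pow_mono[OF n(2) _ _ n'(1)] ac g by (simp add: int_pow_pow mult.commute)
  ultimately have "a [^] (m' * n) \<le>\<^sub>P a [^] (m * n')"
    by (rule le_trans) (use ac g in auto)
  then have "m' * n \<le> m * n'" by (simp add: int_pow_le_iff[OF a])
  then have "of_int m' * of_int n \<le> (of_int m * of_int n' :: real)"
    by (metis of_int_le_iff of_int_mult)
  then show ?thesis using n n' by (simp add: s divide_le_eq field_simps)
qed

lemma slope_ge:
  assumes a: "a \<in> P" and g: "g \<in> carrier G" and n: "0 < n" "a [^] m \<le>\<^sub>P g [^] n"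
  shows "of_int m / of_int n \<le> slope a g"
  unfolding slope_def
proof (rule cSup_upper)
  show "of_int m / of_int n \<in> slope_cut a g" using n by (auto simp: slope_cut_def)
  obtain k :: int where "g \<le>\<^sub>P a [^] k" using archimedean a g by blast
  then have k: "g [^] (1::int) \<le>\<^sub>P a [^] k" using g by simp
  show "bdd_above (slope_cut a g)"
  proof (rule bdd_aboveI)
    fix s assume "s \<in> slope_cut a g"
    from slope_cut_upper[OF a g this _ k] show "s \<le> of_int k / of_int 1" by simp
  qed
qed

lemma slope_le:
  assumes a: "a \<in> P" and g: "g \<in> carrier G" and n: "0 < n" "g [^] n \<le>\<^sub>P a [^] m"
  shows "slope a g \<le> of_int m / of_int n"
  unfolding slope_def
proof (rule cSup_least)
  obtain k :: int where "a [^] k \<le>\<^sub>P g" using archimedean_below a g by blast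
  then have "a [^] k \<le>\<^sub>P g [^] (1::int)" using g by simp
  then have "of_int k / of_int 1 \<in> slope_cut a g"
    unfolding slope_cut_def by (intro CollectI exI[of _ k] exI[of _ 1]) simp
  then show "slope_cut a g \<noteq> {}" by blast
qed (rule slope_cut_upper[OF a g _ n])

text \<open>Locating \<open>g^n\<close> and \<open>h^n\<close> between consecutive powers of \<open>a\<close> confines both sides to
the same interval of length \<open>2/n\<close>; commutativity enters through \<open>(g h)^n = g^n h^n\<close>.\<close>

lemma slope_mult:
  assumes dense: "dense_cone G P" and a: "a \<in> P" and g: "g \<in> carrier G" and h: "h \<in> carrier G"
  shows "slope a (g \<otimes> h) = slope a g + slope a h"
proof -
  have ac: "a \<in> carrier G" using a P_carrier by blast
  have bound: "\<bar>slope a (g \<otimes> h) - (slope a g + slope a h)\<bar> \<le> 2 / of_int n" if n: "0 < n" for n :: int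
  proof -
    obtain k l :: int where k: "a [^] k \<le>\<^sub>P g [^] n" "g [^] n <\<^sub>P a [^] (k + 1)"
      and l: "a [^] l \<le>\<^sub>P h [^] n" "h [^] n <\<^sub>P a [^] (l + 1)"
      using int_floor[OF a int_pow_closed[OF g]] int_floor[OF a int_pow_closed[OF h]] by blast
    have gh: "(g \<otimes> h) [^] n = g [^] n \<otimes> h [^] n"
      by (rule int_pow_mult_distrib[OF commutative[OF dense g h] g h])
    have "a [^] k \<otimes> a [^] l \<le>\<^sub>P g [^] n \<otimes> h [^] n"
      by (rule mult_mono_le[OF k(1) l(1)]) (use ac g h in auto)
    then have lo: "of_int (k + l) / of_int n \<le> slope a (g \<otimes> h)"
      using ac g h by (intro slope_ge a n) (simp_all add: gh int_pow_mult)
    have "g [^] n \<otimes> h [^] n \<le>\<^sub>P a [^] (k + 1) \<otimes> a [^] (l + 1)"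
      by (rule mult_mono_le) (use k l ac g h in \<open>auto simp: le_def\<close>)
    moreover have "a [^] (k + 1) \<otimes> a [^] (l + 1) = a [^] ((k + 1) + (l + 1))"
      using ac by (rule int_pow_mult[symmetric])
    ultimately have hi: "slope a (g \<otimes> h) \<le> of_int ((k + 1) + (l + 1)) / of_int n"
      using g h by (intro slope_le a n) (simp_all add: gh)
    define K where "K = (of_int k / of_int n :: real)"
    define L where "L = (of_int l / of_int n :: real)"
    define e where "e = (1 / of_int n :: real)"
    note defs = K_def L_def e_def
    have "K \<le> slope a g" "L \<le> slope a h"
      using slope_ge[OF a g n k(1)] slope_ge[OF a h n l(1)] by (simp_all add: defs)
    moreover have "g [^] n \<le>\<^sub>P a [^] (k + 1)" "h [^] n \<le>\<^sub>P a [^] (l + 1)"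
      using k l by (simp_all add: le_def)
    then have "slope a g \<le> K + e" "slope a h \<le> L + e"
      using slope_le[OF a g n, of "k + 1"] slope_le[OF a h n, of "l + 1"]
      by (simp_all add: add_divide_distrib defs)
    moreover have "K + L \<le> slope a (g \<otimes> h)" "slope a (g \<otimes> h) \<le> K + L + (e + e)"
      using lo hi by (simp_all add: add_divide_distrib defs)
    moreover have "2 / of_int n = e + e" by (simp add: defs)
    ultimately show ?thesis by (simp only: abs_le_iff) linarith
  qed
  define D where "D = \<bar>slope a (g \<otimes> h) - (slope a g + slope a h)\<bar>"
  have "\<not> 0 < D"
  proof
    assume D: "0 < D"
    obtain n :: nat where n: "2 / D < of_nat n" using reals_Archimedean2 by blast
    moreover have "0 < 2 / D" using D by simp
    ultimately have n0: "0 < real n" by linarith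
    then have "2 / real n < D" using n D by (simp add: divide_less_eq mult.commute)
    moreover have "D \<le> 2 / real n" using bound[of "int n"] n0 unfolding D_def by simp
    ultimately show False by simp
  qed
  then show ?thesis by (simp add: D_def)
qed

lemma slope_pos:
  assumes a: "a \<in> P" and g: "g \<in> P"
  shows "0 < slope a g"
proof -
  have c: "a \<in> carrier G" "g \<in> carrier G" using assms P_carrier by auto
  obtain n :: int where n: "a \<le>\<^sub>P g [^] n" using archimedean[OF g c(1)] by blast
  have "\<one> <\<^sub>P a" using a c one_lt_iff by blast
  then have "\<one> <\<^sub>P g [^] n" by (rule lt_le_trans[OF _ n]) (use c in auto)
  then have "g [^] n \<in> P" using one_lt_iff[of "g [^] n"] c by simp
  then have pos: "0 < n" by (simp only: int_pow_in_P_iff[OF g])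
  have "a [^] (1::int) \<le>\<^sub>P g [^] n" using n c by simp
  then have "of_int 1 / of_int n \<le> slope a g" by (rule slope_ge[OF a c(2) pos])
  moreover have "0 < (of_int 1 / of_int n :: real)" using pos by simp
  ultimately show ?thesis by linarith
qed

end

section \<open>Additive embeddings into a field\<close>

locale additive_embedding = group G for G (structure) +
  fixes \<phi> :: "'a \<Rightarrow> 'k::field_char_0"
  assumes phi_mult: "\<lbrakk>x \<in> carrier G; y \<in> carrier G\<rbrakk> \<Longrightarrow> \<phi> (x \<otimes> y) = \<phi> x + \<phi> y"
    and phi_eq_0: "\<lbrakk>x \<in> carrier G; \<phi> x = 0\<rbrakk> \<Longrightarrow> x = \<one>"
begin

lemma phi_one: "\<phi> \<one> = 0"
  using phi_mult[of \<one> \<one>] by simp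

lemma phi_inv: "x \<in> carrier G \<Longrightarrow> \<phi> (inv x) = - \<phi> x"
  using phi_mult[of x "inv x"] phi_one by (simp add: eq_neg_iff_add_eq_0 add.commute)

lemma phi_inj: "\<lbrakk>x \<in> carrier G; y \<in> carrier G; \<phi> x = \<phi> y\<rbrakk> \<Longrightarrow> x = y"
  using phi_eq_0[of "x \<otimes> inv y"] phi_mult[of x "inv y"] phi_inv[of y]
  by (simp add: inv_solve_right')

lemma phi_nat_pow: "x \<in> carrier G \<Longrightarrow> \<phi> (x [^] (n::nat)) = of_nat n * \<phi> x"
  by (induction n) (simp_all add: phi_one phi_mult algebra_simps)

lemma phi_int_pow: "x \<in> carrier G \<Longrightarrow> \<phi> (x [^] (n::int)) = of_int n * \<phi> x"
  by (cases n rule: int_cases2) (simp_all add: int_pow_int int_pow_neg phi_nat_pow phi_inv)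

end

section \<open>Subgroups of the rationals have rank one\<close>

text \<open>For a group embedded in \<open>\<rat>\<close>, multiplication identifies \<open>A \<otimes> \<rat>\<close> with \<open>\<rat>\<close>. The element \<open>u\<close> only
serves as a unit of measurement.\<close>

locale rationally_embedded_group = comm_group A + additive_embedding A \<phi>
  for A (structure) and \<phi> :: "'a \<Rightarrow> rat" +
  fixes u :: 'a
  assumes u_carrier: "u \<in> carrier A" and u_neq_one: "u \<noteq> \<one>"
begin

lemma phi_u: "\<phi> u \<noteq> 0"
  using phi_eq_0 u_carrier u_neq_one by blast

text \<open>The map \<open>a \<otimes> q \<mapsto> \<phi>(a) q\<close>, lifted to the free abelian group.\<close>

definition tval :: "('a \<times> rat \<Rightarrow>\<^sub>0 int) \<Rightarrow> rat" where
  "tval x = (\<Sum>k\<in>Poly_Mapping.keys x. of_int (Poly_Mapping.lookup x k) * (\<phi> (fst k) * snd k))"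

lemma tval_superset:
  assumes "finite S" "Poly_Mapping.keys x \<subseteq> S"
  shows "tval x = (\<Sum>k\<in>S. of_int (Poly_Mapping.lookup x k) * (\<phi> (fst k) * snd k))"
  unfolding tval_def using assms
  by (intro sum.mono_neutral_left) (auto simp: in_keys_iff)

lemma tval_add: "tval (x + y) = tval x + tval y"
proof -
  let ?S = "Poly_Mapping.keys x \<union> Poly_Mapping.keys y"
  have "tval (x + y) = (\<Sum>k\<in>?S. of_int (Poly_Mapping.lookup (x + y) k) * (\<phi> (fst k) * snd k))"
    by (rule tval_superset) (simp_all add: keys_add)
  also have "\<dots> = tval x + tval y"
    by (simp add: tval_superset[of ?S x] tval_superset[of ?S y] lookup_add ring_distribs sum.distrib)
  finally show ?thesis .
qed

lemma tval_minus: "tval (- x) = - tval x"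
  by (simp add: tval_def sum_negf)

lemma tval_diff: "tval (x - y) = tval x - tval y"
  using tval_add[of x "- y"] by (simp add: tval_minus)

lemma tval_0 [simp]: "tval 0 = 0"
  by (simp add: tval_def)

lemma tval_of [simp]: "tval (frag_of (a, q)) = \<phi> a * q"
  by (simp add: tval_def)

abbreviation "F \<equiv> tensor_rat_free A"
abbreviation "R \<equiv> tensor_rat_rel A"

lemma R_gens_carrier:
  "{frag_of (a \<otimes> b, q) - frag_of (a, q) - frag_of (b, q) | a b q. a \<in> carrier A \<and> b \<in> carrier A} \<union>
   {frag_of (a, q + r) - frag_of (a, q) - frag_of (a, r) | a q r. a \<in> carrier A} \<subseteq> carrier F"
proof -
  have diff: "x - y \<in> carrier F" if "x \<in> carrier F" "y \<in> carrier F" for x y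
    using that order_trans[OF keys_diff[of x y] Un_least]
    unfolding carrier_free_Abelian_group_iff by simp
  show ?thesis
    by (intro subsetI, elim UnE CollectE exE conjE; hypsubst; intro diff; simp)
qed

lemma R_subgroup: "subgroup R F"
  unfolding tensor_rat_rel_def
  by (rule group.generate_is_subgroup[OF group_free_Abelian_group R_gens_carrier])

lemma R_carrier: "x \<in> R \<Longrightarrow> x \<in> carrier F"
  using subgroup.subset[OF R_subgroup] by blast

lemma R_add: "\<lbrakk>x \<in> R; y \<in> R\<rbrakk> \<Longrightarrow> x + y \<in> R"
  using subgroup.m_closed[OF R_subgroup] by simp

lemma R_minus: "x \<in> R \<Longrightarrow> - x \<in> R"
  using subgroup.m_inv_closed[OF R_subgroup, of x] R_carrier[of x] by simp

lemma R_diff: "\<lbrakk>x \<in> R; y \<in> R\<rbrakk> \<Longrightarrow> x - y \<in> R"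
  using R_add[OF _ R_minus, of x y] by simp

lemma R_trans: "\<lbrakk>x - y \<in> R; y - z \<in> R\<rbrakk> \<Longrightarrow> x - z \<in> R"
  using R_add[of "x - y" "y - z"] by simp

lemma R_sym: "x - y \<in> R \<Longrightarrow> y - x \<in> R"
  using R_minus[of "x - y"] by simp

lemma R_left: "\<lbrakk>a \<in> carrier A; b \<in> carrier A\<rbrakk> \<Longrightarrow>
    frag_of (a \<otimes> b, q) - frag_of (a, q) - frag_of (b, q) \<in> R"
  unfolding tensor_rat_rel_def by (rule generate.incl) blast

lemma R_right: "a \<in> carrier A \<Longrightarrow> frag_of (a, q + r) - frag_of (a, q) - frag_of (a, r) \<in> R"
  unfolding tensor_rat_rel_def by (rule generate.incl) blast

lemma R_tval: "x \<in> R \<Longrightarrow> tval x = 0"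
  unfolding tensor_rat_rel_def
proof (induction x rule: generate.induct)
  case (incl h)
  then show ?case
    by (elim UnE CollectE exE conjE) (simp_all add: tval_diff phi_mult ring_distribs)
next
  case (inv h)
  then have "tval h = 0"
    by (elim UnE CollectE exE conjE) (simp_all add: tval_diff phi_mult ring_distribs)
  moreover have "Poly_Mapping.keys h \<subseteq> carrier A \<times> UNIV"
    using subsetD[OF R_gens_carrier inv] by simp
  ultimately show ?case by (simp add: tval_minus)
qed (auto simp: tval_add)

text \<open>A map from the integers that is additive modulo the relations is determined modulo the
relations by its value at \<open>1\<close>. Both slots of a tensor give such maps, which is how integer
factors move across.\<close>

lemma R_additive_multiple:
  fixes f :: "int \<Rightarrow> 'a \<times> rat \<Rightarrow>\<^sub>0 int"
  assumes f: "\<And>i j. f (i + j) - f i - f j \<in> R"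
  shows "f n - frag_cmul n (f 1) \<in> R"
proof (induction n rule: int_induct[where k = 0])
  case base
  show ?case using R_minus[OF f[of 0 0]] by simp
next
  case (step1 i)
  have "f (i + 1) - frag_cmul (i + 1) (f 1) = (f (i + 1) - f i - f 1) + (f i - frag_cmul i (f 1))"
    by (simp add: frag_cmul_distrib)
  then show ?case using R_add[OF f step1(2)] by (simp only:)
next
  case (step2 i)
  have "f (i - 1) - frag_cmul (i - 1) (f 1) = (f i - frag_cmul i (f 1)) - (f ((i - 1) + 1) - f (i - 1) - f 1)"
    by (simp add: frag_cmul_diff_distrib)
  then show ?case using R_diff[OF step2(2) f] by (simp only:)
qed

lemma R_pow_left: "a \<in> carrier A \<Longrightarrow> frag_of (a [^] (n::int), q) - frag_cmul n (frag_of (a, q)) \<in> R"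
  using R_additive_multiple[of "\<lambda>n. frag_of (a [^] n, q)" n] R_left
  by (simp add: int_pow_mult)

lemma R_mult_right: "a \<in> carrier A \<Longrightarrow> frag_of (a, of_int n * q) - frag_cmul n (frag_of (a, q)) \<in> R"
  using R_additive_multiple[of "\<lambda>n. frag_of (a, of_int n * q)" n] R_right
  by (simp add: ring_distribs)

lemma R_swap: "a \<in> carrier A \<Longrightarrow> frag_of (a [^] (n::int), q) - frag_of (a, of_int n * q) \<in> R"
  by (rule R_trans[OF R_pow_left R_sym[OF R_mult_right]])

lemma R_u_0: "0 - frag_of (u, 0) \<in> R"
  using R_right[OF u_carrier, of 0 0] by simp

text \<open>If \<open>a^n = u^m\<close>, then \<open>a \<otimes> q = a^n \<otimes> q/n = u^m \<otimes> q/n = u \<otimes> mq/n\<close>.\<close>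

lemma R_generator_multiple_of_u:
  assumes a: "a \<in> carrier A"
  shows "\<exists>r. frag_of (a, q) - frag_of (u, r) \<in> R"
proof -
  obtain m n :: int where n: "n > 0" and mn: "\<phi> a / \<phi> u = of_int m / of_int n"
    by (metis quotient_of_div quotient_of_denom_pos surj_pair)
  have "of_int n * \<phi> a = of_int m * \<phi> u"
    using mn n phi_u by (simp add: field_simps)
  then have eq: "a [^] n = u [^] m"
    using a u_carrier by (intro phi_inj) (simp_all add: phi_int_pow)
  have "frag_of (a, of_int n * (q / of_int n)) - frag_of (u, of_int m * (q / of_int n)) \<in> R"
    using R_trans[OF R_sym[OF R_swap[OF a, of n "q / of_int n"]], unfolded eq] R_swap[OF u_carrier]
    by blast
  then show ?thesis using n by fastforce
qed

lemma R_multiple_of_u: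
  assumes "x \<in> carrier F"
  shows "\<exists>r. x - frag_of (u, r) \<in> R"
proof -
  have keys: "Poly_Mapping.keys x \<subseteq> carrier A \<times> (UNIV :: rat set)" using assms by simp
  show ?thesis
  proof (rule free_Abelian_group_induct[OF keys])
    show "\<exists>r. 0 - frag_of (u, r) \<in> R" using R_u_0 by blast
  next
    fix x y :: "'a \<times> rat \<Rightarrow>\<^sub>0 int"
    assume "\<exists>r. x - frag_of (u, r) \<in> R" "\<exists>r. y - frag_of (u, r) \<in> R"
    then obtain r s where rs: "x - frag_of (u, r) \<in> R" "y - frag_of (u, s) \<in> R" by blast
    have "(x - y) - frag_of (u, r - s) = (x - frag_of (u, r)) - (y - frag_of (u, s))
          + (frag_of (u, (r - s) + s) - frag_of (u, r - s) - frag_of (u, s))"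
      by simp
    also have "\<dots> \<in> R" by (intro R_add R_diff rs R_right u_carrier)
    finally show "\<exists>r. (x - y) - frag_of (u, r) \<in> R" by blast
  next
    fix k assume "k \<in> carrier A \<times> (UNIV :: rat set)"
    then show "\<exists>r. frag_of k - frag_of (u, r) \<in> R"
      using R_generator_multiple_of_u by (cases k) auto
  qed
qed

text \<open>The cosets of the relation subgroup turn out to be exactly the fibres of the valuation, so
that they can be calculated with as rational numbers.\<close>

definition fibre :: "rat \<Rightarrow> ('a \<times> rat \<Rightarrow>\<^sub>0 int) set" where
  "fibre q = {x \<in> carrier F. tval x = q}"

text \<open>Modulo the relations every element is of the form \<open>u \<otimes> r\<close>, whose value
\<open>\<phi>(u) r\<close> vanishes only for \<open>r = 0\<close>.\<close>

lemma R_eq_fibre: "R = fibre 0"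
proof (intro equalityI subsetI)
  fix x assume "x \<in> R"
  then show "x \<in> fibre 0" using R_tval R_carrier by (simp add: fibre_def)
next
  fix x assume x: "x \<in> fibre 0"
  then obtain r where r: "x - frag_of (u, r) \<in> R"
    using R_multiple_of_u by (auto simp: fibre_def)
  then have "tval (x - frag_of (u, r)) = 0" by (rule R_tval)
  then have "r = 0" using x phi_u by (simp add: tval_diff fibre_def)
  then show "x \<in> R" using R_trans[OF r R_sym[of 0 "frag_of (u, r)"]] R_u_0 by simp
qed

lemma fibre_witness: "frag_of (u, q / \<phi> u) \<in> fibre q"
  using u_carrier phi_u by (simp add: fibre_def)

lemma fibre_diff: "\<lbrakk>x \<in> fibre p; y \<in> fibre q\<rbrakk> \<Longrightarrow> x - y \<in> fibre (p - q)"
  by (force simp: fibre_def tval_diff dest: subsetD[OF keys_diff])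

lemma fibre_inj: "fibre p = fibre q \<longleftrightarrow> p = q"
  using fibre_witness[of p] unfolding fibre_def by (metis (mono_tags, lifting) mem_Collect_eq)

text \<open>One summand may be any nonempty part of its fibre. This covers the single representatives in
the definition of cosets and the image that occurs in the scalar multiplication.\<close>

lemma set_mult_fibre:
  assumes "X \<noteq> {}" "X \<subseteq> fibre q"
  shows "fibre p <#>\<^bsub>F\<^esub> X = fibre (p + q)"
proof (intro equalityI subsetI)
  fix z assume "z \<in> fibre p <#>\<^bsub>F\<^esub> X"
  then show "z \<in> fibre (p + q)"
    using assms by (force simp: set_mult_def fibre_def tval_add dest: subsetD[OF keys_add])
next
  fix z assume z: "z \<in> fibre (p + q)"
  obtain y where y: "y \<in> X" using assms by blast
  then have "y \<in> fibre q" using assms by blast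
  then have "z - y \<in> fibre p"
    using z by (force simp: fibre_def tval_diff dest: subsetD[OF keys_diff])
  then show "z \<in> fibre p <#>\<^bsub>F\<^esub> X"
    using y by (force simp: set_mult_def)
qed

lemma carrier_tensor_rat: "carrier (tensor_rat A) = range fibre"
proof -
  have "R #>\<^bsub>F\<^esub> x = fibre (tval x)" if "x \<in> carrier F" for x
  proof -
    have "{x} \<subseteq> fibre (tval x)" using that by (simp add: fibre_def)
    then show ?thesis
      using set_mult_fibre[of "{x}" "tval x" 0] by (simp add: r_coset_eq_set_mult R_eq_fibre)
  qed
  then have "carrier (tensor_rat A) = (\<lambda>x. fibre (tval x)) ` carrier F"
    by (simp only: tensor_rat_def carrier_FactGroup partial_object.simps cong: image_cong)
  also have "\<dots> = range fibre"
  proof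
    show "range fibre \<subseteq> (\<lambda>x. fibre (tval x)) ` carrier F"
    proof
      fix Y assume "Y \<in> range fibre"
      then obtain q where q: "Y = fibre q" by blast
      show "Y \<in> (\<lambda>x. fibre (tval x)) ` carrier F"
        using fibre_witness[of q] unfolding q
        by (intro image_eqI[where x = "frag_of (u, q / \<phi> u)"]) (simp_all add: fibre_def)
    qed
  qed blast
  finally show ?thesis .
qed

lemma zero_tensor_rat: "\<zero>\<^bsub>tensor_rat A\<^esub> = fibre 0"
  by (simp add: tensor_rat_def R_eq_fibre)

lemma add_tensor_rat: "fibre p \<oplus>\<^bsub>tensor_rat A\<^esub> fibre q = fibre (p + q)"
  using set_mult_fibre[of "fibre q" q p] fibre_witness by (auto simp: tensor_rat_def)

lemma frag_extend_scale:
  assumes "x \<in> carrier F"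
  shows "frag_extend (\<lambda>(a, s). frag_of (a, r * s)) x \<in> fibre (r * tval x)"
proof -
  have keys: "Poly_Mapping.keys x \<subseteq> carrier A \<times> (UNIV :: rat set)" using assms by simp
  let ?f = "\<lambda>(a, s). frag_of (a, r * s)"
  show ?thesis
  proof (rule free_Abelian_group_induct[OF keys])
    fix x y assume "frag_extend ?f x \<in> fibre (r * tval x)" "frag_extend ?f y \<in> fibre (r * tval y)"
    then have "frag_extend ?f x - frag_extend ?f y \<in> fibre (r * tval x - r * tval y)"
      by (rule fibre_diff)
    then show "frag_extend ?f (x - y) \<in> fibre (r * tval (x - y))"
      by (simp only: frag_extend_diff tval_diff right_diff_distrib)
  next
    show "frag_extend ?f 0 \<in> fibre (r * tval 0)" by (simp add: fibre_def)
  next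
    fix k assume "k \<in> carrier A \<times> (UNIV :: rat set)"
    then show "frag_extend ?f (frag_of k) \<in> fibre (r * tval (frag_of k))"
      by (cases k) (simp add: fibre_def)
  qed
qed

lemma smult_tensor_rat: "r \<odot>\<^bsub>tensor_rat A\<^esub> fibre q = fibre (r * q)"
proof -
  have "frag_extend (\<lambda>(a, s). frag_of (a, r * s)) ` fibre q \<subseteq> fibre (r * q)"
    using frag_extend_scale by (auto simp: fibre_def)
  then show ?thesis
    using set_mult_fibre[of "frag_extend (\<lambda>(a, s). frag_of (a, r * s)) ` fibre q" "r * q" 0]
      fibre_witness[of q] by (auto simp: tensor_rat_def R_eq_fibre)
qed

lemma abelian_group_tensor_rat: "abelian_group (tensor_rat A)"
proof (rule abelian_groupI)
  fix X assume "X \<in> carrier (tensor_rat A)"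
  then obtain q where "X = fibre q" by (auto simp: carrier_tensor_rat)
  then have "fibre (- q) \<oplus>\<^bsub>tensor_rat A\<^esub> X = \<zero>\<^bsub>tensor_rat A\<^esub>"
    by (simp add: add_tensor_rat zero_tensor_rat)
  then show "\<exists>Y\<in>carrier (tensor_rat A). Y \<oplus>\<^bsub>tensor_rat A\<^esub> X = \<zero>\<^bsub>tensor_rat A\<^esub>"
    by (auto simp: carrier_tensor_rat)
qed (auto simp: carrier_tensor_rat add_tensor_rat zero_tensor_rat add_ac)

lemma module_tensor_rat: "module class_ring (tensor_rat A)"
proof (intro moduleI abelian_group_tensor_rat)
  show "cring (class_ring :: rat ring)"
    by (rule class_cring.is_cring)
next
  fix r X assume "X \<in> carrier (tensor_rat A)"
  then show "r \<odot>\<^bsub>tensor_rat A\<^esub> X \<in> carrier (tensor_rat A)"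
    by (auto simp: carrier_tensor_rat smult_tensor_rat)
next
  fix r s X assume "X \<in> carrier (tensor_rat A)"
  then obtain q where X: "X = fibre q" by (auto simp: carrier_tensor_rat)
  show "(r \<oplus>\<^bsub>class_ring\<^esub> s) \<odot>\<^bsub>tensor_rat A\<^esub> X
      = r \<odot>\<^bsub>tensor_rat A\<^esub> X \<oplus>\<^bsub>tensor_rat A\<^esub> s \<odot>\<^bsub>tensor_rat A\<^esub> X"
    by (simp add: X add_tensor_rat smult_tensor_rat distrib_right)
  show "(r \<otimes>\<^bsub>class_ring\<^esub> s) \<odot>\<^bsub>tensor_rat A\<^esub> X
      = r \<odot>\<^bsub>tensor_rat A\<^esub> (s \<odot>\<^bsub>tensor_rat A\<^esub> X)"
    by (simp add: X smult_tensor_rat mult.assoc)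
next
  fix r X Y assume "X \<in> carrier (tensor_rat A)" "Y \<in> carrier (tensor_rat A)"
  then obtain p q where XY: "X = fibre p" "Y = fibre q" by (auto simp: carrier_tensor_rat)
  show "r \<odot>\<^bsub>tensor_rat A\<^esub> (X \<oplus>\<^bsub>tensor_rat A\<^esub> Y)
      = r \<odot>\<^bsub>tensor_rat A\<^esub> X \<oplus>\<^bsub>tensor_rat A\<^esub> r \<odot>\<^bsub>tensor_rat A\<^esub> Y"
    by (simp add: XY add_tensor_rat smult_tensor_rat distrib_left)
next
  fix X assume "X \<in> carrier (tensor_rat A)"
  then obtain q where X: "X = fibre q" by (auto simp: carrier_tensor_rat)
  show "\<one>\<^bsub>class_ring\<^esub> \<odot>\<^bsub>tensor_rat A\<^esub> X = X"
    by (simp add: X smult_tensor_rat)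
qed

lemma vectorspace_tensor_rat: "vectorspace class_ring (tensor_rat A)"
  by (intro vectorspace.intro class_field module_tensor_rat)

lemma abelian_of_rank_1: "abelian_of_rank A 1"
proof -
  interpret V: vectorspace "class_ring :: rat ring" "tensor_rat A"
    by (rule vectorspace_tensor_rat)
  have f1: "fibre 1 \<in> carrier (tensor_rat A)" by (auto simp: carrier_tensor_rat)
  have gen: "V.gen_set {fibre 1}"
  proof
    show "carrier (tensor_rat A) \<subseteq> V.span {fibre 1}"
    proof
      fix X assume "X \<in> carrier (tensor_rat A)"
      then obtain q where "X = q \<odot>\<^bsub>tensor_rat A\<^esub> fibre 1"
        by (auto simp: carrier_tensor_rat smult_tensor_rat)
      moreover have "submodule class_ring (V.span {fibre 1}) (tensor_rat A)"
        using f1 by (intro V.span_is_submodule) auto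
      moreover have "fibre 1 \<in> V.span {fibre 1}" using V.in_own_span[of "{fibre 1}"] f1 by auto
      ultimately show "X \<in> V.span {fibre 1}"
        by (simp add: submodule_def)
    qed
  qed (use V.span_is_subset2[of "{fibre 1}"] f1 in auto)
  have "V.dim = 1"
    using gen f1 by (intro V.dim1I) (auto simp: zero_tensor_rat fibre_inj)
  moreover have "V.fin_dim"
    unfolding V.fin_dim_def using gen f1 by blast
  moreover have "torsion_free A"
    unfolding torsion_free_def
  proof (intro ballI allI impI)
    fix a n assume a: "a \<in> carrier A" "n > 0 \<and> a [^] (n::nat) = \<one>"
    then have "of_nat n * \<phi> a = 0" using phi_nat_pow[of a n] phi_one by simp
    then show "a = \<one>" using a phi_eq_0 by simp
  qed
  ultimately show ?thesis
    unfolding abelian_of_rank_def using comm_group_axioms by blast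
qed

end

section \<open>Orderings induced by the real line\<close>

locale real_embedded_group = additive_embedding G \<phi> for G (structure) and \<phi> :: "'a \<Rightarrow> real"
begin

definition pos :: "'a set" where
  "pos = {x \<in> carrier G. 0 < \<phi> x}"

lemma left_cone_pos: "left_cone G pos"
proof -
  have "x = \<one> \<or> 0 < \<phi> x \<or> 0 < \<phi> (inv x)" if "x \<in> carrier G" for x
    using phi_eq_0[OF that] phi_inv[OF that] by (cases "\<phi> x = 0") auto
  then have "\<forall>x\<in>carrier G. x = \<one> \<or> x \<in> pos \<or> inv x \<in> pos" by (simp add: pos_def)
  then show ?thesis
    by (simp add: left_cone_def) (simp add: pos_def phi_one phi_mult subset_iff)
qed

text \<open>Division with remainder: the remainder of \<open>h\<close> by \<open>g\<close> would be a smaller positive element.\<close>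

lemma powers_of_least_positive:
  assumes g: "g \<in> pos" and least: "\<And>f. f \<in> pos \<Longrightarrow> inv f \<otimes> g \<notin> pos" and h: "h \<in> carrier G"
  shows "\<exists>k::int. h = g [^] k"
proof -
  have gc: "g \<in> carrier G" and g0: "0 < \<phi> g" using g by (auto simp: pos_def)
  define k where "k = \<lfloor>\<phi> h / \<phi> g\<rfloor>"
  define r where "r = h \<otimes> g [^] (- k)"
  have rc: "r \<in> carrier G" using gc h by (simp add: r_def)
  have r: "\<phi> r = \<phi> h - of_int k * \<phi> g" using gc h by (simp add: r_def phi_mult phi_int_pow)
  have "of_int k \<le> \<phi> h / \<phi> g" "\<phi> h / \<phi> g < of_int k + 1" unfolding k_def by linarith+
  then have "0 \<le> \<phi> r" "\<phi> r < \<phi> g" using g0 by (simp_all add: r field_simps)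
  moreover have "\<not> 0 < \<phi> r"
  proof
    assume "0 < \<phi> r"
    then have "r \<in> pos" using rc by (simp add: pos_def)
    moreover have "inv r \<otimes> g \<in> pos"
      using rc gc \<open>\<phi> r < \<phi> g\<close> by (simp add: pos_def phi_mult phi_inv)
    ultimately show False using least by blast
  qed
  ultimately have "r = \<one>" using phi_eq_0 rc by simp
  then have "h \<otimes> g [^] (- k) \<otimes> g [^] k = g [^] k" using gc by (simp add: r_def)
  then have "h = g [^] k" using gc h by (simp add: m_assoc int_pow_neg)
  then show ?thesis by blast
qed

text \<open>Every element is a power of a generator \<open>t\<close>, so no value of \<open>\<phi>\<close> lies strictly between \<open>0\<close> and
\<open>\<bar>\<phi> t\<bar>\<close>.\<close>

lemma integer_group_not_dense:
  assumes iso: "G \<cong> integer_group"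
  shows "\<not> dense_cone G pos"
proof
  assume dense: "dense_cone G pos"
  obtain h where h: "h \<in> iso G integer_group" using iso by (auto simp: is_iso_def)
  then have hom: "h \<in> hom G integer_group" and bij: "bij_betw h (carrier G) UNIV"
    by (auto simp: iso_def)
  obtain t where t: "t \<in> carrier G" "h t = 1" using bij by (metis UNIV_I bij_betw_iff_bijections)
  have powers: "x = t [^] h x" if "x \<in> carrier G" for x
  proof (rule inj_onD[OF bij_betw_imp_inj_on[OF bij]])
    show "h x = h (t [^] h x)"
      using hom_int_pow[OF hom t(1) group_axioms group_integer_group] t by simp
  qed (use that t in auto)
  have "\<phi> t \<noteq> 0"
  proof
    assume "\<phi> t = 0"
    then have "t = \<one>" using phi_eq_0 t by blast
    then have "t [^] (2::int) = t [^] (1::int)" by simp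
    then show False
      using hom_int_pow[OF hom t(1) group_axioms group_integer_group, of 2] t by simp
  qed
  then have "t \<in> pos \<and> \<phi> t = \<bar>\<phi> t\<bar> \<or> inv t \<in> pos \<and> \<phi> (inv t) = \<bar>\<phi> t\<bar>"
    using t by (auto simp: pos_def phi_inv)
  then obtain s where s: "s \<in> pos" "\<phi> s = \<bar>\<phi> t\<bar>" by blast
  then obtain f where f: "f \<in> pos" "inv f \<otimes> s \<in> pos" using dense by (auto simp: dense_cone_def)
  then have c: "f \<in> carrier G" "s \<in> carrier G" using s by (auto simp: pos_def)
  have f_lt: "0 < \<phi> f" "\<phi> f < \<bar>\<phi> t\<bar>"
    using f c s by (auto simp: pos_def phi_mult phi_inv)
  have "\<phi> f = of_int (h f) * \<phi> t" using powers[OF c(1)] phi_int_pow[OF t(1)] by metis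
  then have "\<bar>real_of_int (h f)\<bar> * \<bar>\<phi> t\<bar> < 1 * \<bar>\<phi> t\<bar>" "h f \<noteq> 0" using f_lt by (auto simp: abs_mult)
  then have "\<bar>real_of_int (h f)\<bar> < 1" by (simp only: mult_less_cancel_right)
  then show False using \<open>h f \<noteq> 0\<close> by linarith
qed

text \<open>Dividing the embedding by its value at \<open>u\<close> gives an embedding into the rationals.\<close>

lemma rank_1_of_commensurable:
  assumes u: "u \<in> carrier G" "u \<noteq> \<one>"
    and q: "\<And>x. x \<in> carrier G \<Longrightarrow> \<exists>q::rat. \<phi> x = of_rat q * \<phi> u"
  shows "abelian_of_rank G 1"
proof -
  have u0: "\<phi> u \<noteq> 0" using phi_eq_0 u by blast
  define \<rho> where "\<rho> x = (SOME q::rat. \<phi> x = of_rat q * \<phi> u)" for x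
  have \<rho>: "\<phi> x = of_rat (\<rho> x) * \<phi> u" if "x \<in> carrier G" for x
    unfolding \<rho>_def by (rule someI_ex[OF q[OF that]])
  have "x \<otimes> y = y \<otimes> x" if "x \<in> carrier G" "y \<in> carrier G" for x y
    by (rule phi_inj) (use that in \<open>simp_all add: phi_mult\<close>)
  then have comm: "comm_group G" by (rule group_comm_groupI)
  have emb: "additive_embedding G \<rho>"
  proof
    fix x y assume xy: "x \<in> carrier G" "y \<in> carrier G"
    have "of_rat (\<rho> (x \<otimes> y)) * \<phi> u = \<phi> x + \<phi> y"
      using \<rho>[OF m_closed[OF xy]] phi_mult[OF xy] by linarith
    also have "\<dots> = of_rat (\<rho> x) * \<phi> u + of_rat (\<rho> y) * \<phi> u"
      using \<rho>[OF xy(1)] \<rho>[OF xy(2)] by linarith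
    also have "\<dots> = of_rat (\<rho> x + \<rho> y) * \<phi> u"
      by (simp only: of_rat_add distrib_right)
    finally have "of_rat (\<rho> (x \<otimes> y)) = (of_rat (\<rho> x + \<rho> y) :: real)"
      using u0 by (rule mult_right_cancel[THEN iffD1, rotated])
    then show "\<rho> (x \<otimes> y) = \<rho> x + \<rho> y" by (simp only: of_rat_eq_iff)
  next
    fix x assume x: "x \<in> carrier G" "\<rho> x = 0"
    then have "\<phi> x = 0" using \<rho>[OF x(1)] by (simp only: of_rat_0 mult_zero_left)
    then show "x = \<one>" using x phi_eq_0 by blast
  qed
  show ?thesis
    by (intro rationally_embedded_group.abelian_of_rank_1[where \<phi> = \<rho> and u = u]
        rationally_embedded_group.intro rationally_embedded_group_axioms.intro comm emb u)
qed

end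

text \<open>Two real numbers that are linearly independent over \<open>\<rat>\<close> are part of a rational basis of the
reals, and a linear map may be prescribed on a basis.\<close>

lemma rational_functional:
  fixes x y :: real
  assumes "x \<noteq> 0" "\<And>q::rat. y \<noteq> of_rat q * x"
  shows "\<exists>\<psi>::real \<Rightarrow> real. (\<forall>s t. \<psi> (s + t) = \<psi> s + \<psi> t) \<and> \<psi> x = 0 \<and> \<psi> y = 1"
proof -
  let ?scale = "\<lambda>(q::rat) (r::real). of_rat q * r"
  interpret V: vector_space_pair ?scale ?scale
    by unfold_locales (simp_all add: of_rat_add of_rat_mult ring_distribs)
  have "V.vs1.independent {x}"
    using assms(1) by (simp add: V.vs1.independent_insert)
  moreover have "y \<notin> V.vs1.span {x}"
    using assms(2) by (auto simp: V.vs1.span_singleton)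
  ultimately have "V.vs1.independent {y, x}"
    by (rule V.vs1.independent_insertI[rotated])
  then obtain g where g: "Vector_Spaces.linear ?scale ?scale g"
    and gB: "\<forall>z\<in>{y, x}. g z = (if z = y then 1 else 0)"
    using V.linear_independent_extend[of "{y, x}" "\<lambda>z. if z = y then 1 else 0"] by blast
  interpret g: Vector_Spaces.linear ?scale ?scale g by (rule g)
  have "y \<noteq> x" using assms(2)[of 1] by simp
  then have "g x = 0" "g y = 1" using gB by auto
  moreover have "g (s + t) = g s + g t" for s t
    by (rule g.add)
  ultimately show ?thesis by blast
qed

text \<open>Density of the rationals, rescaled by \<open>x\<close>; a negative \<open>x\<close> is absorbed in the sign of \<open>m\<close>.\<close>

lemma rational_multiple_between:
  fixes x a b :: real
  assumes "x \<noteq> 0" "a < b"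
  obtains m n :: int where "0 < n" "a < of_int m / of_int n * x" "of_int m / of_int n * x < b"
proof -
  have "a / \<bar>x\<bar> < b / \<bar>x\<bar>" using assms by (simp add: divide_strict_right_mono)
  then obtain r where r: "r \<in> \<rat>" "a / \<bar>x\<bar> < r" "r < b / \<bar>x\<bar>"
    using Rats_dense_in_real by blast
  obtain m n :: int where n: "0 < n" and rmn: "r = of_int m / of_int n"
    using r(1) by (rule Rats_cases')
  have bounds: "a < r * \<bar>x\<bar>" "r * \<bar>x\<bar> < b"
    using r(2,3) assms(1) by (simp_all add: pos_divide_less_eq pos_less_divide_eq)
  show thesis
  proof (cases "0 < x")
    case True
    then show thesis using that[of n m] n bounds rmn by simp
  next
    case False
    then show thesis using that[of n "- m"] n bounds rmn by simp
  qed
qed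

context real_embedded_group
begin

text \<open>With \<open>\<psi>\<close> rational-linear, \<open>\<psi>(\<phi> u) = 0\<close> and \<open>\<psi>(\<phi> v) = 1\<close>, consider
\<open>\<phi> + \<epsilon> \<psi> \<phi>\<close>. It is injective unless \<open>\<epsilon>\<close> is one of countably many values, and positive on \<open>F\<close>
for small \<open>\<epsilon>\<close>. The new order is dense because a least positive element would generate the group,
making \<open>u\<close> and \<open>v\<close> commensurable. It is new because the ratio of the
values of \<open>v\<close> and \<open>u\<close> has moved past some rational number.\<close>

lemma perturbation:
  assumes count: "countable (carrier G)"
    and u: "u \<in> carrier G" "u \<noteq> \<one>" and v: "v \<in> carrier G"
    and indep: "\<And>q::rat. \<phi> v \<noteq> of_rat q * \<phi> u"
    and F: "finite F" "F \<subseteq> pos"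
  shows "\<exists>Q. dense_cone G Q \<and> F \<subseteq> Q \<and> Q \<noteq> pos"
proof -
  have u0: "\<phi> u \<noteq> 0" using phi_eq_0 u by blast
  from rational_functional[OF u0 indep]
  obtain \<psi> :: "real \<Rightarrow> real"
    where \<psi>: "(\<forall>s t. \<psi> (s + t) = \<psi> s + \<psi> t) \<and> \<psi> (\<phi> u) = 0 \<and> \<psi> (\<phi> v) = 1" ..
  have \<psi>_add: "\<psi> (s + t) = \<psi> s + \<psi> t" for s t
    by (rule conjunct1[OF \<psi>, THEN spec, THEN spec])
  have \<psi>u: "\<psi> (\<phi> u) = 0" by (rule conjunct1[OF conjunct2[OF \<psi>]])
  have \<psi>v: "\<psi> (\<phi> v) = 1" by (rule conjunct2[OF conjunct2[OF \<psi>]])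
  \<comment> \<open>below the minimum of \<open>B\<close> the values on \<open>F\<close> stay positive; the entry \<open>1\<close> provides for empty \<open>F\<close>\<close>
  define B where "B = insert 1 ((\<lambda>f. \<phi> f / (\<bar>\<psi> (\<phi> f)\<bar> + 1)) ` F)"
  have B: "finite B" "B \<noteq> {}" "\<forall>b\<in>B. 0 < b"
    using F by (auto simp: B_def pos_def intro!: divide_pos_pos)
  define \<delta> where "\<delta> = Min B"
  have \<delta>: "0 < \<delta>" unfolding \<delta>_def using Min_in[OF B(1,2)] B(3) by blast
  \<comment> \<open>the values of \<open>\<epsilon>\<close> for which some nontrivial element could be sent to \<open>0\<close>\<close>
  define bad where "bad = (\<lambda>x. - \<phi> x / \<psi> (\<phi> x)) ` carrier G"
  have "uncountable {0<..<\<delta>}" using \<delta> by (simp add: uncountable_open_interval)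
  moreover have "countable bad" using count by (simp add: bad_def)
  ultimately have "\<not> {0<..<\<delta>} \<subseteq> bad" using countable_subset by blast
  then obtain \<epsilon> where "\<epsilon> \<in> {0<..<\<delta>}" "\<epsilon> \<notin> bad" by blast
  then have \<epsilon>: "0 < \<epsilon>" "\<epsilon> < \<delta>" "\<epsilon> \<notin> bad" by simp_all
  interpret Q: real_embedded_group G "\<lambda>x. \<phi> x + \<epsilon> * \<psi> (\<phi> x)"
  proof
    fix x y assume "x \<in> carrier G" "y \<in> carrier G"
    then show "\<phi> (x \<otimes> y) + \<epsilon> * \<psi> (\<phi> (x \<otimes> y)) = \<phi> x + \<epsilon> * \<psi> (\<phi> x) + (\<phi> y + \<epsilon> * \<psi> (\<phi> y))"
      by (simp add: phi_mult \<psi>_add distrib_left)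
  next
    fix x assume x: "x \<in> carrier G" "\<phi> x + \<epsilon> * \<psi> (\<phi> x) = 0"
    show "x = \<one>"
    proof (cases "\<psi> (\<phi> x) = 0")
      case True
      then show ?thesis using x phi_eq_0 by simp
    next
      case False
      have "\<epsilon> = \<epsilon> * \<psi> (\<phi> x) / \<psi> (\<phi> x)" using False by simp
      also have "\<epsilon> * \<psi> (\<phi> x) = - \<phi> x" using x(2) by linarith
      finally have "\<epsilon> = - \<phi> x / \<psi> (\<phi> x)" .
      then have "\<epsilon> \<in> bad" using x(1) unfolding bad_def by (rule image_eqI)
      then show ?thesis using \<epsilon>(3) by blast
    qed
  qed
  have pos': "x \<in> Q.pos \<longleftrightarrow> x \<in> carrier G \<and> 0 < \<phi> x + \<epsilon> * \<psi> (\<phi> x)" for x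
    by (simp add: Q.pos_def)
  have "dense_cone G Q.pos"
    unfolding dense_cone_def
  proof (intro conjI ballI Q.left_cone_pos)
    fix g assume g: "g \<in> Q.pos"
    show "\<exists>f\<in>Q.pos. inv f \<otimes> g \<in> Q.pos"
    proof (rule ccontr)
      assume no: "\<not> ?thesis"
      have gc: "g \<in> carrier G" using g pos' by blast
      have pow: "\<exists>k::int. h = g [^] k" if "h \<in> carrier G" for h
        by (rule Q.powers_of_least_positive[OF g _ that]) (use no in blast)
      obtain k :: int where k: "u = g [^] k" using pow[OF u(1)] by blast
      obtain l :: int where l: "v = g [^] l" using pow[OF v] by blast
      have \<phi>kl: "\<phi> u = of_int k * \<phi> g" "\<phi> v = of_int l * \<phi> g"
        unfolding k l by (rule phi_int_pow[OF gc])+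
      then have "real_of_int k \<noteq> 0" using u0 by auto
      then have "\<phi> v = of_rat (of_int l / of_int k) * \<phi> u"
        by (simp add: \<phi>kl of_rat_divide)
      then show False using indep by blast
    qed
  qed
  moreover have "F \<subseteq> Q.pos"
  proof
    fix f assume f: "f \<in> F"
    then have fp: "f \<in> carrier G" "0 < \<phi> f" using F by (auto simp: pos_def)
    have "\<delta> \<le> \<phi> f / (\<bar>\<psi> (\<phi> f)\<bar> + 1)"
      unfolding \<delta>_def using f B by (intro Min_le) (auto simp: B_def)
    then have "\<epsilon> < \<phi> f / (\<bar>\<psi> (\<phi> f)\<bar> + 1)" using \<epsilon> by linarith
    then have "\<epsilon> * (\<bar>\<psi> (\<phi> f)\<bar> + 1) < \<phi> f" by (simp add: less_divide_eq)
    then have "\<epsilon> * \<bar>\<psi> (\<phi> f)\<bar> + \<epsilon> < \<phi> f" by (simp add: distrib_left)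
    moreover have "\<bar>\<epsilon> * \<psi> (\<phi> f)\<bar> = \<epsilon> * \<bar>\<psi> (\<phi> f)\<bar>" using \<epsilon> by (simp add: abs_mult)
    ultimately have "0 < \<phi> f + \<epsilon> * \<psi> (\<phi> f)" using \<epsilon>(1) by linarith
    then show "f \<in> Q.pos" using fp pos' by blast
  qed
  moreover have "Q.pos \<noteq> pos"
  proof -
    define \<alpha> where "\<alpha> = \<phi> u"
    define \<beta> where "\<beta> = \<phi> v"
    have "\<alpha> \<noteq> 0" "\<beta> < \<beta> + \<epsilon>" using u0 \<epsilon>(1) by (simp_all add: \<alpha>_def)
    then obtain m n :: int where n: "0 < n" and "\<beta> < of_int m / of_int n * \<alpha>"
      "of_int m / of_int n * \<alpha> < \<beta> + \<epsilon>"
      by (rule rational_multiple_between)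
    define r where "r = (of_int m / of_int n :: real)"
    have between: "\<beta> < r * \<alpha>" "r * \<alpha> < \<beta> + \<epsilon>" unfolding r_def by fact+
    have n0: "0 < real_of_int n" using n by simp
    \<comment> \<open>old value \<open>n (\<beta> - r \<alpha>) < 0\<close>, new value \<open>n (\<beta> + \<epsilon> - r \<alpha>) > 0\<close>\<close>
    define w where "w = v [^] n \<otimes> u [^] (- m)"
    have wc: "w \<in> carrier G" using u v by (simp add: w_def)
    have \<phi>w: "\<phi> w = of_int n * \<beta> - of_int m * \<alpha>"
      using phi_mult[of "v [^] n" "u [^] (- m)"] phi_int_pow[OF v, of n] phi_int_pow[OF u(1), of "- m"] u v
      by (simp add: w_def \<alpha>_def \<beta>_def)
    have Qw: "\<phi> w + \<epsilon> * \<psi> (\<phi> w) = of_int n * (\<beta> + \<epsilon>) - of_int m * \<alpha>"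
      using Q.phi_mult[of "v [^] n" "u [^] (- m)"] Q.phi_int_pow[OF v, of n] Q.phi_int_pow[OF u(1), of "- m"] u v
      by (simp add: w_def \<alpha>_def \<beta>_def \<psi>u \<psi>v)
    have m: "of_int m * \<alpha> = of_int n * (r * \<alpha>)" using n0 by (simp add: r_def)
    have "\<phi> w = of_int n * (\<beta> - r * \<alpha>)" by (simp only: \<phi>w m right_diff_distrib)
    then have "\<phi> w < 0" using n0 between(1) by (simp add: mult_pos_neg)
    then have "w \<notin> pos" by (simp add: pos_def)
    moreover have "\<phi> w + \<epsilon> * \<psi> (\<phi> w) = of_int n * (\<beta> + \<epsilon> - r * \<alpha>)"
      by (simp only: Qw m right_diff_distrib)
    then have "0 < \<phi> w + \<epsilon> * \<psi> (\<phi> w)" using n0 between(2) by simp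
    then have "w \<in> Q.pos" using wc pos' by blast
    ultimately show ?thesis by blast
  qed
  ultimately show ?thesis by blast
qed

end

section \<open>Dense cones are not isolated among dense cones\<close>

text \<open>Isolation forces bi-invariance, and the absence of convex subgroups then forces the order to be
archimedean. The resulting real embedding is treated according to whether its image has
rational rank one.\<close>

lemma (in left_ordered_group) not_isolated_of_simple:
  assumes dense: "dense_cone G P"
    and count: "countable (carrier G)"
    and rank: "abelian_of_rank G 1 \<Longrightarrow> G \<cong> integer_group"
    and F: "finite F" "F \<noteq> {}" "F \<subseteq> P"
    and simple: "\<And>H. convex_subgroup H \<Longrightarrow> H = {\<one>} \<or> H = carrier G"
  shows "\<exists>Q. dense_cone G Q \<and> F \<subseteq> Q \<and> Q \<noteq> P"
proof (rule ccontr)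
  assume no: "\<not> ?thesis"
  have bi: "right_invariant = carrier G"
    using no by (intro right_invariant_of_isolated[OF dense F _ simple]) auto
  interpret archimedean_ordered_group G P
  proof
    fix a g assume a: "a \<in> P" and g: "g \<in> carrier G"
    let ?B = "{g \<in> carrier G. \<exists>n::nat. inv (a [^] n) \<le>\<^sub>P g \<and> g \<le>\<^sub>P a [^] n}"
    have ac: "a \<in> carrier G" using a P_carrier by blast
    have B: "convex_subgroup ?B" using a ac bi by (intro convex_subgroup_of_powers) auto
    have "\<one> <\<^sub>P a" using a ac one_lt_iff by blast
    moreover have "inv a <\<^sub>P \<one>" using lt_mult_left[of "inv a" \<one> a] calculation ac by simp
    ultimately have "inv a <\<^sub>P a" using lt_trans[of "inv a" \<one> a] ac by simp
    then have "a \<in> ?B" using ac by (auto simp: le_def intro!: exI[of _ 1])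
    moreover have "a \<noteq> \<one>" using a one_notin_P by blast
    ultimately have "g \<in> ?B" using simple[OF B] g by blast
    then obtain n :: nat where "g \<le>\<^sub>P a [^] n" by blast
    then have "g \<le>\<^sub>P a [^] int n" by (simp add: int_pow_int)
    then show "\<exists>n::int. g \<le>\<^sub>P a [^] n" by blast
  qed (rule bi)
  obtain a where a: "a \<in> P" using F by blast
  have ac: "a \<in> carrier G" and a1: "a \<noteq> \<one>" using a P_carrier one_notin_P by auto
  interpret real_embedded_group G "slope a"
  proof
    show "slope a (x \<otimes> y) = slope a x + slope a y" if "x \<in> carrier G" "y \<in> carrier G" for x y
      by (rule slope_mult[OF dense a that])
    then have "slope a \<one> = slope a \<one> + slope a \<one>" by (metis one_closed r_one)
    then have s1: "slope a \<one> = 0" by simp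
    fix x assume x: "x \<in> carrier G" "slope a x = 0"
    have "slope a (x \<otimes> inv x) = slope a x + slope a (inv x)"
      using x by (intro slope_mult[OF dense a]) auto
    then have "slope a (inv x) = 0" using x s1 by simp
    then show "x = \<one>" using P_cases[OF x(1)] slope_pos[OF a, of x] slope_pos[OF a, of "inv x"] x by auto
  qed
  have P_eq: "P = pos"
  proof
    show "P \<subseteq> pos" using slope_pos[OF a] P_carrier by (auto simp: pos_def)
    show "pos \<subseteq> P"
    proof
      fix x assume "x \<in> pos"
      then have x: "x \<in> carrier G" "0 < slope a x" by (auto simp: pos_def)
      have "inv x \<notin> P" using slope_pos[OF a, of "inv x"] phi_inv[OF x(1)] x by auto
      moreover have "x \<noteq> \<one>" using x phi_one by auto
      ultimately show "x \<in> P" using P_cases[OF x(1)] by blast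
    qed
  qed
  show False
  proof (cases "\<forall>x\<in>carrier G. \<exists>q::rat. slope a x = of_rat q * slope a a")
    case True
    then have "abelian_of_rank G 1" by (intro rank_1_of_commensurable[OF ac a1]) blast
    then show False using integer_group_not_dense[OF rank] dense P_eq by simp
  next
    case False
    then obtain v where v: "v \<in> carrier G" "\<forall>q::rat. slope a v \<noteq> of_rat q * slope a a" by blast
    have "\<exists>Q. dense_cone G Q \<and> F \<subseteq> Q \<and> Q \<noteq> pos"
      by (rule perturbation[OF count ac a1 v(1) _ F(1)]) (use v(2) F(3) P_eq in simp_all)
    then show False using no P_eq by simp
  qed
qed

text \<open>If every nontrivial convex subgroup meets \<open>F\<close>, then by convexity each of them contains
the least element \<open>a\<close> of \<open>F\<close>, and the convex subgroup generated by \<open>a\<close> has no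
proper nontrivial convex subgroup. A new order on that subgroup extends to the whole group.\<close>

theorem (in group) dense_cone_not_isolated:
  assumes dense: "dense_cone G P"
    and count: "countable (carrier G)"
    and rank: "\<And>H. \<lbrakk>subgroup H G; abelian_of_rank (G\<lparr>carrier := H\<rparr>) 1\<rbrakk> \<Longrightarrow> G\<lparr>carrier := H\<rparr> \<cong> integer_group"
    and F: "finite F" "F \<noteq> {}" "F \<subseteq> P"
  shows "\<exists>Q. dense_cone G Q \<and> F \<subseteq> Q \<and> Q \<noteq> P"
proof -
  interpret left_ordered_group G P
    using dense by unfold_locales (simp add: dense_cone_def)
  have Fc: "F \<subseteq> carrier G" using F P_carrier by blast
  obtain a where a: "a \<in> F" and least: "\<And>f. f \<in> F \<Longrightarrow> a \<le>\<^sub>P f"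
    using finite_has_least[OF F(1,2) Fc] by blast
  have aP: "a \<in> P" and ac: "a \<in> carrier G" using a F Fc by auto
  show ?thesis
  proof (cases "\<exists>H. convex_subgroup H \<and> H \<noteq> {\<one>} \<and> F \<inter> H = {}")
    case True
    then show ?thesis using flip_convex_subgroup dense F(3) by blast
  next
    case False
    have a_mem: "a \<in> H" if H: "convex_subgroup H" "H \<noteq> {\<one>}" for H
    proof -
      obtain f where f: "f \<in> F" "f \<in> H" using False H by blast
      then have "a = f \<or> inv a \<otimes> f \<in> P" using least[OF f(1)] by (simp add: le_def lt_def)
      then show ?thesis using convex_subgroupD[OF H(1) aP f(2)] f by blast
    qed
    define C where "C = \<Inter>{H. convex_subgroup H \<and> a \<in> H}"
    have C: "convex_subgroup C"
      unfolding C_def using convex_carrier ac by (intro convex_Inter) auto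
    have aC: "a \<in> C" by (simp add: C_def)
    have subC: "subgroup C G" using C by (simp add: convex_subgroup_def)
    have C_min: "C \<subseteq> H" if "convex_subgroup H" "H \<noteq> {\<one>}" for H
      using a_mem[OF that] that(1) unfolding C_def by blast
    let ?C = "G\<lparr>carrier := C\<rparr>"
    interpret C: left_ordered_group ?C "P \<inter> C"
      by (intro left_ordered_group.intro left_ordered_group_axioms.intro
          subgroup_imp_group subC restrict_left_cone)
    have simple: "H = {\<one>\<^bsub>?C\<^esub>} \<or> H = carrier ?C" if H: "C.convex_subgroup H" for H
    proof -
      have HC: "H \<subseteq> C" and subH: "subgroup H G"
        using H incl_subgroup[OF subC] subgroup.subset by (fastforce simp: C.convex_subgroup_def)+
      have "convex_subgroup H"
        unfolding convex_subgroup_def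
      proof (intro conjI ballI impI subH)
        fix f g assume f: "f \<in> carrier G" "\<one> <\<^sub>P f" and g: "g \<in> H" "f <\<^sub>P g"
        have fP: "f \<in> P" using f one_lt_iff by blast
        have fg: "inv f \<otimes> g \<in> P" using g by (simp add: lt_def)
        have fC: "f \<in> C" using convex_subgroupD[OF C fP _ fg] g HC by blast
        have "inv f \<otimes> g \<in> C"
          using fC g HC subgroup.m_closed[OF subC subgroup.m_inv_closed[OF subC]] by blast
        then show "f \<in> H"
          using C.convex_subgroupD[OF H, of f g] fP fC fg g m_inv_consistent[OF subC fC] by simp
      qed
      then show ?thesis using C_min HC by auto
    qed
    have "\<exists>Q. dense_cone ?C Q \<and> F \<inter> C \<subseteq> Q \<and> Q \<noteq> P \<inter> C"
    proof (rule C.not_isolated_of_simple)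
      show "dense_cone ?C (P \<inter> C)" by (rule restrict_dense_cone[OF C dense])
      show "countable (carrier ?C)"
        using count subgroup.subset[OF subC] countable_subset by auto
      show "?C \<cong> integer_group" if "abelian_of_rank ?C 1" by (rule rank[OF subC that])
      show "finite (F \<inter> C)" using F by simp
      show "F \<inter> C \<noteq> {}" using a aC by blast
      show "F \<inter> C \<subseteq> P \<inter> C" using F by blast
      show "H = {\<one>\<^bsub>?C\<^esub>} \<or> H = carrier ?C" if "C.convex_subgroup H" for H
        by (rule simple[OF that])
    qed
    then obtain Q where Q: "dense_cone ?C Q" "F \<inter> C \<subseteq> Q" "Q \<noteq> P \<inter> C" by blast
    have QC: "Q \<subseteq> C" using Q(1) by (simp add: dense_cone_def left_cone_def)
    have "dense_cone G ((P - C) \<union> Q)"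
      using Q(1,2) a aC by (intro replace_dense_cone[OF C]) auto
    moreover have "F \<subseteq> (P - C) \<union> Q" using F(3) Q(2) by blast
    moreover have "(P - C) \<union> Q \<noteq> P" using Q(3) QC by blast
    ultimately show ?thesis by blast
  qed
qed

section \<open>Ternary expansions of the points of the Cantor set\<close>

text \<open>The point of the Cantor set whose ternary digits are \<open>2\<close> at the places where \<open>b\<close> is true and
\<open>0\<close> elsewhere.\<close>

definition cantor_code :: "(nat \<Rightarrow> bool) \<Rightarrow> real" where
  "cantor_code b = suminf (\<lambda>k. 2 * of_bool (b k) / 3 ^ Suc k)"

lemma cantor_code_sums_all_ones: "(\<lambda>k. 2 / 3 ^ Suc k :: real) sums 1"
  using sums_mult[OF geometric_sums[of "1/3::real"], of "2/3"]
  by (simp add: power_one_over field_simps)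

lemma summable_cantor_code: "summable (\<lambda>k. 2 * of_bool (b k) / 3 ^ Suc k :: real)"
  by (rule summable_comparison_test[OF _ sums_summable[OF cantor_code_sums_all_ones]])
    (auto intro!: exI[of _ 0])

lemma cantor_code_step: "cantor_code b = (2 * of_bool (b 0) + cantor_code (\<lambda>k. b (Suc k))) / 3"
proof -
  have "cantor_code b = suminf (\<lambda>k. 2 * of_bool (b (Suc k)) / 3 ^ Suc (Suc k)) + 2 * of_bool (b 0) / 3"
    using suminf_split_head[OF summable_cantor_code[of b]] unfolding cantor_code_def by simp
  also have "suminf (\<lambda>k. 2 * of_bool (b (Suc k)) / 3 ^ Suc (Suc k) :: real)
      = suminf (\<lambda>k. (2 * of_bool (b (Suc k)) / 3 ^ Suc k) / 3)"
    by (simp add: mult.commute)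
  also have "\<dots> = cantor_code (\<lambda>k. b (Suc k)) / 3"
    unfolding cantor_code_def by (rule suminf_divide[OF summable_cantor_code])
  finally show ?thesis by (simp add: add_divide_distrib)
qed

lemma cantor_code_bounds: "0 \<le> cantor_code b" "cantor_code b \<le> 1"
proof -
  show "0 \<le> cantor_code b"
    unfolding cantor_code_def by (rule suminf_nonneg[OF summable_cantor_code]) simp
  have "cantor_code b \<le> suminf (\<lambda>k. 2 / 3 ^ Suc k)"
    unfolding cantor_code_def
    by (rule suminf_le[OF _ summable_cantor_code sums_summable[OF cantor_code_sums_all_ones]]) simp
  then show "cantor_code b \<le> 1"
    by (simp only: sums_unique[OF cantor_code_sums_all_ones, symmetric])
qed

lemma cantor_code_in_cantor_set: "cantor_code b \<in> cantor_set"
proof -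
  have "cantor_code b \<in> cantor_stage n" for n
  proof (induction n arbitrary: b)
    case 0
    then show ?case using cantor_code_bounds by simp
  next
    case (Suc n)
    have "cantor_code (\<lambda>k. b (Suc k)) \<in> cantor_stage n" by (rule Suc)
    then show ?case by (cases "b 0") (auto simp: cantor_code_step[of b])
  qed
  then show ?thesis by (simp add: cantor_set_def)
qed

lemma cantor_code_close:
  assumes "\<And>j. j < k \<Longrightarrow> b j = c j"
  shows "\<bar>cantor_code b - cantor_code c\<bar> \<le> (1 / 3) ^ k"
  using assms
proof (induction k arbitrary: b c)
  case 0
  show ?case using cantor_code_bounds[of b] cantor_code_bounds[of c] by simp
next
  case (Suc k)
  have "\<bar>cantor_code (\<lambda>k. b (Suc k)) - cantor_code (\<lambda>k. c (Suc k))\<bar> \<le> (1 / 3) ^ k"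
    by (rule Suc.IH) (simp add: Suc.prems)
  moreover have "b 0 = c 0" by (simp add: Suc.prems)
  ultimately show ?case
    by (simp add: cantor_code_step[of b] cantor_code_step[of c] diff_divide_distrib[symmetric] abs_divide)
qed

lemma cantor_code_inj: "cantor_code b = cantor_code c \<Longrightarrow> b = c"
proof
  fix k
  assume "cantor_code b = cantor_code c"
  then show "b k = c k"
  proof (induction k arbitrary: b c)
    have "b 0 = c 0 \<and> cantor_code (\<lambda>k. b (Suc k)) = cantor_code (\<lambda>k. c (Suc k))"
      if "cantor_code b = cantor_code c" for b c
      using that cantor_code_bounds[of "\<lambda>k. b (Suc k)"] cantor_code_bounds[of "\<lambda>k. c (Suc k)"]
      by (cases "b 0"; cases "c 0") (simp_all add: cantor_code_step[of b] cantor_code_step[of c])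
    note step = this
    case 0
    then show ?case using step by blast
    case (Suc k)
    then show ?case using step by blast
  qed
qed

text \<open>On the Cantor set this deletes the first ternary digit: it is inverse to \<open>x/3\<close> on the left third
and to \<open>(2 + x)/3\<close> on the right third.\<close>

definition cantor_shift :: "real \<Rightarrow> real" where
  "cantor_shift x = (if x \<le> 1 / 3 then 3 * x else 3 * x - 2)"

lemma cantor_stage_bounds: "x \<in> cantor_stage n \<Longrightarrow> 0 \<le> x \<and> x \<le> 1"
  by (induction n arbitrary: x) force+

lemma cantor_shift_in_cantor_set:
  assumes "x \<in> cantor_set"
  shows "cantor_shift x \<in> cantor_set"
proof -
  have "cantor_shift x \<in> cantor_stage n" for n
  proof -
    have "x \<in> cantor_stage (Suc n)"
      using assms unfolding cantor_set_def by blast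
    then obtain y where y: "y \<in> cantor_stage n" "x = y / 3 \<or> x = (2 + y) / 3" by auto
    then have "cantor_shift x = y"
      using cantor_stage_bounds[of y n] by (auto simp: cantor_shift_def)
    then show ?thesis using y by simp
  qed
  then show ?thesis by (simp add: cantor_set_def)
qed

text \<open>The digits of \<open>x\<close> are read off from its orbit under the shift. Each digit reduces
the distance between \<open>x\<close> and the number with these digits by a factor of \<open>3\<close>.\<close>

lemma cantor_code_surj:
  assumes "x \<in> cantor_set"
  shows "\<exists>b. cantor_code b = x"
proof -
  define bits where "bits x = (\<lambda>k. (cantor_shift ^^ k) x > 1 / 3)" for x
  have approx: "\<bar>y - cantor_code (bits y)\<bar> \<le> (1 / 3) ^ k" if "y \<in> cantor_set" for k y
    using that
  proof (induction k arbitrary: y)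
    case 0
    then have "y \<in> cantor_stage 0" unfolding cantor_set_def by blast
    then show ?case using cantor_code_bounds[of "bits y"] by (simp add: abs_le_iff)
  next
    case (Suc k)
    have "bits (cantor_shift y) = (\<lambda>k. bits y (Suc k))"
      by (simp add: bits_def funpow_swap1)
    moreover have "y = (2 * of_bool (bits y 0) + cantor_shift y) / 3"
      by (simp add: bits_def cantor_shift_def)
    ultimately have eq: "y - cantor_code (bits y) = (cantor_shift y - cantor_code (bits (cantor_shift y))) / 3"
      by (simp add: cantor_code_step[of "bits y"] field_simps)
    show ?case
      using Suc.IH[OF cantor_shift_in_cantor_set[OF Suc.prems]] unfolding eq by (simp add: abs_divide)
  qed
  have "(\<lambda>k. (1 / 3) ^ k :: real) \<longlonglongrightarrow> 0"
    by (rule LIMSEQ_power_zero) simp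
  then have "\<bar>x - cantor_code (bits x)\<bar> \<le> 0"
    by (rule LIMSEQ_le_const) (use approx[OF assms] in blast)
  then show ?thesis by (intro exI[of _ "bits x"]) simp
qed

section \<open>Perfect compact spaces with a countable separating family of clopen sets\<close>

text \<open>A cell is always split along the first set of the family that cuts it. As a set that has been
used never cuts again, every set of the family is eventually dealt with.\<close>

definition first_cut :: "(nat \<Rightarrow> 'a set) \<Rightarrow> 'a set \<Rightarrow> nat" where
  "first_cut U C = (LEAST n. C \<inter> U n \<noteq> {} \<and> C - U n \<noteq> {})"

primrec cell :: "(nat \<Rightarrow> 'a set) \<Rightarrow> 'a set \<Rightarrow> (nat \<Rightarrow> bool) \<Rightarrow> nat \<Rightarrow> 'a set" where
  "cell U S b 0 = S"
| "cell U S b (Suc k) = (let C = cell U S b k; A = U (first_cut U C)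
     in if b k then C \<inter> A else C - A)"

text \<open>The same subdivision as \<open>cell\<close>, steered by a point instead of a bit sequence: the
cell at depth \<open>k\<close> that contains \<open>x\<close>.\<close>

primrec cell_of :: "(nat \<Rightarrow> 'a set) \<Rightarrow> 'a set \<Rightarrow> 'a \<Rightarrow> nat \<Rightarrow> 'a set" where
  "cell_of U S x 0 = S"
| "cell_of U S x (Suc k) = (let C = cell_of U S x k; A = U (first_cut U C)
     in if x \<in> A then C \<inter> A else C - A)"

definition itinerary :: "(nat \<Rightarrow> 'a set) \<Rightarrow> 'a set \<Rightarrow> 'a \<Rightarrow> nat \<Rightarrow> bool" where
  "itinerary U S x k \<longleftrightarrow> x \<in> U (first_cut U (cell_of U S x k))"

lemma cell_itinerary: "cell U S (itinerary U S x) k = cell_of U S x k"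
  by (induction k) (simp_all add: itinerary_def Let_def)

lemma mem_cell_of: "x \<in> S \<Longrightarrow> x \<in> cell_of U S x k"
  by (induction k) (simp_all add: Let_def)

lemma cell_subset: "cell U S b k \<subseteq> S"
  by (induction k) (auto simp: Let_def)

lemma cell_Suc_subset: "cell U S b (Suc k) \<subseteq> cell U S b k"
  by (auto simp: Let_def)

lemma itinerary_unique:
  assumes "x \<in> cell U S b k" "j < k"
  shows "itinerary U S x j = b j"
proof -
  have "cell_of U S x k = cell U S b k \<and> (\<forall>j<k. itinerary U S x j = b j)"
    using assms(1)
  proof (induction k)
    case (Suc k)
    have "x \<in> cell U S b k" using Suc.prems cell_Suc_subset by (rule rev_subsetD)
    then have eq: "cell_of U S x k = cell U S b k" and bits: "\<forall>j<k. itinerary U S x j = b j"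
      using Suc.IH by blast+
    have b: "b k \<longleftrightarrow> x \<in> U (first_cut U (cell U S b k))"
      using Suc.prems by (simp add: Let_def split: if_splits)
    then have "cell_of U S x (Suc k) = cell U S b (Suc k)"
      by (simp add: Let_def eq)
    moreover have "itinerary U S x k = b k"
      using b by (simp add: itinerary_def eq)
    ultimately show ?case using bits less_Suc_eq by auto
  qed simp
  then show ?thesis using assms(2) by blast
qed

locale perfect_clopen_space =
  fixes X :: "'a topology" and U :: "nat \<Rightarrow> 'a set"
  assumes compact: "compact_space X"
    and open_U: "openin X (U n)"
    and closed_U: "closedin X (U n)"
    and separating: "\<lbrakk>x \<in> topspace X; y \<in> topspace X; \<And>n. x \<in> U n \<longleftrightarrow> y \<in> U n\<rbrakk> \<Longrightarrow> x = y"
    and perfect: "\<lbrakk>openin X V; x \<in> V\<rbrakk> \<Longrightarrow> \<exists>y\<in>V. y \<noteq> x"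
    and nonempty: "topspace X \<noteq> {}"
begin

abbreviation "D \<equiv> cell U (topspace X)"

lemma first_cut_cuts:
  assumes "openin X C" "C \<noteq> {}"
  shows "C \<inter> U (first_cut U C) \<noteq> {}" "C - U (first_cut U C) \<noteq> {}"
proof -
  obtain x y where xy: "x \<in> C" "y \<in> C" "y \<noteq> x" using assms perfect by blast
  then have "x \<in> topspace X" "y \<in> topspace X" using assms openin_subset by blast+
  then obtain n where "(x \<in> U n) \<noteq> (y \<in> U n)" using separating xy by blast
  then have "C \<inter> U n \<noteq> {} \<and> C - U n \<noteq> {}" using xy by blast
  then have "C \<inter> U (first_cut U C) \<noteq> {} \<and> C - U (first_cut U C) \<noteq> {}"
    unfolding first_cut_def by (rule LeastI)
  then show "C \<inter> U (first_cut U C) \<noteq> {}" "C - U (first_cut U C) \<noteq> {}" by blast+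
qed

lemma open_cell: "openin X (D b k)"
  by (induction k) (auto simp: Let_def open_U closed_U intro: openin_Int openin_diff)

lemma closed_cell: "closedin X (D b k)"
  by (induction k) (auto simp: Let_def open_U closed_U intro: closedin_Int closedin_diff)

text \<open>By perfectness a nonempty open cell has two points, so some member of the family cuts it and
both halves are again nonempty.\<close>

lemma cell_nonempty: "D b k \<noteq> {}"
proof (induction k)
  case (Suc k)
  then show ?case using first_cut_cuts[OF open_cell Suc] by (simp add: Let_def)
qed (use nonempty in simp)

text \<open>At depth \<open>k\<close> none of the first \<open>k\<close> sets cuts a cell: if the first set that cuts a
cell at depth \<open>k\<close> is number \<open>k\<close>, it is used in the next step, and otherwise number \<open>k\<close>
did not cut the cell anyway.\<close>

lemma cell_not_cut: "n < k \<Longrightarrow> D b k \<inter> U n = {} \<or> D b k - U n = {}"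
proof (induction k arbitrary: n)
  case (Suc k)
  let ?m = "first_cut U (D b k)"
  show ?case
  proof (cases "n < k")
    case True
    then have "D b k \<inter> U n = {} \<or> D b k - U n = {}" by (rule Suc.IH)
    then show ?thesis using cell_Suc_subset[of U "topspace X" b k] by blast
  next
    case False
    then have n: "n = k" using Suc.prems by simp
    have cut: "D b k \<inter> U ?m \<noteq> {}" "D b k - U ?m \<noteq> {}"
      using first_cut_cuts[OF open_cell cell_nonempty] by blast+
    show ?thesis
    proof (cases "?m = k")
      case True
      then have "D b (Suc k) = (if b k then D b k \<inter> U k else D b k - U k)"
        by (simp add: Let_def)
      then show ?thesis unfolding n by (cases "b k") auto
    next
      case False
      have "\<not> ?m < k" using Suc.IH cut by blast
      then have "k < ?m" using False by simp
      then have "\<not> (D b k \<inter> U k \<noteq> {} \<and> D b k - U k \<noteq> {})"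
        unfolding first_cut_def by (rule not_less_Least)
      then show ?thesis
        unfolding n using cell_Suc_subset[of U "topspace X" b k] by blast
    qed
  qed
qed simp

lemma itinerary_inj:
  assumes "x \<in> topspace X" "y \<in> topspace X"
    and eq: "itinerary U (topspace X) x = itinerary U (topspace X) y"
  shows "x = y"
proof (rule separating[OF assms(1,2)])
  fix n
  let ?D = "D (itinerary U (topspace X) x) (Suc n)"
  have "x \<in> ?D" "y \<in> ?D"
    using mem_cell_of[OF assms(1)] mem_cell_of[OF assms(2)] cell_itinerary eq by metis+
  then show "x \<in> U n \<longleftrightarrow> y \<in> U n"
    using cell_not_cut[of n "Suc n" "itinerary U (topspace X) x"] by blast
qed

lemma itinerary_surj: "\<exists>x\<in>topspace X. itinerary U (topspace X) x = b"
proof -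
  have "(\<Inter>n. D b n) \<noteq> {}"
    by (rule compact_space_imp_nest[OF compact closed_cell cell_nonempty], rule decseq_SucI,
        rule cell_Suc_subset)
  then obtain x where x: "\<And>k. x \<in> D b k" by blast
  then have "itinerary U (topspace X) x = b"
    by (intro ext itinerary_unique[OF x lessI])
  then show ?thesis using x[of 0] by auto
qed

lemma continuous_code: "continuous_map X euclideanreal (\<lambda>x. cantor_code (itinerary U (topspace X) x))"
  unfolding continuous_map_def
proof (intro conjI allI impI)
  fix V :: "real set"
  assume "openin euclideanreal V"
  then have V: "open V" by simp
  let ?f = "\<lambda>x. cantor_code (itinerary U (topspace X) x)"
  show "openin X {x \<in> topspace X. ?f x \<in> V}"
  proof (subst openin_subopen, intro ballI)
    fix x assume x: "x \<in> {x \<in> topspace X. ?f x \<in> V}"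
    then have "?f x \<in> V" by simp
    from V this obtain e where e: "e > 0" "ball (?f x) e \<subseteq> V" by (rule openE)
    obtain k where k: "(1 / 3) ^ k < e" using real_arch_pow_inv[OF e(1), of "1/3"] by auto
    let ?N = "D (itinerary U (topspace X) x) k"
    have "?f y \<in> V" if "y \<in> ?N" for y
    proof -
      have "\<bar>?f x - ?f y\<bar> \<le> (1 / 3) ^ k"
        by (rule cantor_code_close) (rule itinerary_unique[OF that, symmetric])
      then have "?f y \<in> ball (?f x) e" using k by (simp add: dist_real_def)
      then show ?thesis using e(2) by blast
    qed
    then have sub: "?N \<subseteq> {x \<in> topspace X. ?f x \<in> V}"
      using cell_subset[of U "topspace X" "itinerary U (topspace X) x" k] by (simp add: subset_iff)
    have "x \<in> ?N" using x by (simp add: cell_itinerary mem_cell_of)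
    with sub open_cell show "\<exists>T. openin X T \<and> x \<in> T \<and> T \<subseteq> {x \<in> topspace X. ?f x \<in> V}"
      by (intro exI[of _ ?N] conjI)
  qed
qed simp

text \<open>Brouwer's characterization of the Cantor set. Recording the side taken at each split identifies
the space with the space of bit sequences.\<close>

theorem homeomorphic_cantor_set: "X homeomorphic_space top_of_set cantor_set"
proof -
  let ?f = "\<lambda>x. cantor_code (itinerary U (topspace X) x)"
  have "homeomorphic_map X (top_of_set cantor_set) ?f"
  proof (rule continuous_imp_homeomorphic_map[OF _ compact])
    show "continuous_map X (top_of_set cantor_set) ?f"
      using continuous_code cantor_code_in_cantor_set by (simp add: continuous_map_in_subtopology Pi_iff)
    show "?f ` topspace X = topspace (top_of_set cantor_set)"
    proof
      show "topspace (top_of_set cantor_set) \<subseteq> ?f ` topspace X"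
      proof
        fix c assume "c \<in> topspace (top_of_set cantor_set)"
        then have "c \<in> cantor_set" by simp
        then obtain b where b: "cantor_code b = c" using cantor_code_surj by blast
        obtain x where "x \<in> topspace X" "itinerary U (topspace X) x = b"
          using itinerary_surj[of b] by blast
        then show "c \<in> ?f ` topspace X" using b by (intro image_eqI[of _ _ x]) simp_all
      qed
    qed (simp add: cantor_code_in_cantor_set image_subset_iff)
    show "inj_on ?f (topspace X)"
      by (intro inj_onI itinerary_inj cantor_code_inj)
  qed (simp add: Hausdorff_space_subtopology)
  then show ?thesis by (rule homeomorphic_map_imp_homeomorphic_space)
qed

end

section \<open>The topology on the set of subsets\<close>

lemma topspace_powerset_topology: "topspace (powerset_topology A) = Pow A"
  by (auto simp: powerset_topology_def topspace_pullback_topology)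

lemma continuous_map_member:
  assumes "g \<in> A"
  shows "continuous_map (powerset_topology A) (discrete_topology UNIV) (\<lambda>P. g \<in> P)"
proof (rule continuous_map_eq)
  show "continuous_map (powerset_topology A) (discrete_topology UNIV) ((\<lambda>x. x g) \<circ> (\<lambda>P. \<lambda>g\<in>A. g \<in> P))"
    unfolding powerset_topology_def
    by (intro continuous_map_pullback continuous_map_product_projection assms)
qed (simp add: assms)

lemma clopen_member:
  assumes "g \<in> A"
  shows "openin (powerset_topology A) {P \<in> Pow A. g \<in> P}"
    and "closedin (powerset_topology A) {P \<in> Pow A. g \<in> P}"
    and "openin (powerset_topology A) {P \<in> Pow A. g \<notin> P}"
    and "closedin (powerset_topology A) {P \<in> Pow A. g \<notin> P}"
  using openin_continuous_map_preimage[OF continuous_map_member[OF assms], of "{True}"]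
    closedin_continuous_map_preimage[OF continuous_map_member[OF assms], of "{True}"]
    openin_continuous_map_preimage[OF continuous_map_member[OF assms], of "{False}"]
    closedin_continuous_map_preimage[OF continuous_map_member[OF assms], of "{False}"]
  by (simp_all add: topspace_powerset_topology)

lemma compact_powerset_topology: "compact_space (powerset_topology A)"
proof -
  let ?T = "product_topology (\<lambda>_. discrete_topology (UNIV :: bool set)) A"
  let ?h = "\<lambda>x. {g \<in> A. x g}"
  have "continuous_map ?T ?T ((\<lambda>P. \<lambda>g\<in>A. g \<in> P) \<circ> ?h)"
    by (rule continuous_map_eq[OF continuous_map_id]) (auto simp: PiE_def extensional_def fun_eq_iff)
  then have "continuous_map ?T (powerset_topology A) ?h"
    unfolding powerset_topology_def by (rule continuous_map_pullback') auto
  moreover have "compact_space ?T"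
    by (simp add: compact_space_product_topology compact_space_discrete_topology)
  then have "compactin ?T (topspace ?T)" by (simp only: compact_space_def)
  ultimately have "compactin (powerset_topology A) (?h ` topspace ?T)"
    by (rule image_compactin[rotated])
  moreover have "?h ` topspace ?T = Pow A"
  proof
    show "Pow A \<subseteq> ?h ` topspace ?T"
    proof
      fix P assume "P \<in> Pow A"
      then show "P \<in> ?h ` topspace ?T"
        by (intro image_eqI[where x = "\<lambda>g\<in>A. g \<in> P"]) auto
    qed
  qed auto
  ultimately show ?thesis by (simp add: compact_space_def topspace_powerset_topology)
qed

text \<open>A neighbourhood in the product topology restricts only finitely many coordinates.\<close>

lemma powerset_topology_neighbourhood:
  assumes W: "openin (powerset_topology A) W" and P: "P \<in> W"
  obtains F where "finite F" "F \<subseteq> A" "\<And>Q. \<lbrakk>Q \<subseteq> A; \<forall>g\<in>F. g \<in> Q \<longleftrightarrow> g \<in> P\<rbrakk> \<Longrightarrow> Q \<in> W"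
proof -
  let ?T = "product_topology (\<lambda>_. discrete_topology (UNIV :: bool set)) A"
  let ?f = "\<lambda>P. \<lambda>g\<in>A. g \<in> P"
  obtain V where V: "openin ?T V" "W = ?f -` V \<inter> Pow A"
    using W unfolding powerset_topology_def openin_pullback_topology by blast
  have "?f P \<in> V" using P V(2) by blast
  then obtain U where U: "finite {i \<in> A. U i \<noteq> (UNIV :: bool set)}" "?f P \<in> Pi\<^sub>E A U" "Pi\<^sub>E A U \<subseteq> V"
    using V(1) unfolding openin_product_topology_alt topspace_discrete_topology by meson
  let ?F = "{i \<in> A. U i \<noteq> (UNIV :: bool set)}"
  have "Q \<in> W" if Q: "Q \<subseteq> A" "\<forall>g\<in>?F. g \<in> Q \<longleftrightarrow> g \<in> P" for Q
  proof -
    have "(g \<in> Q) \<in> U g" if g: "g \<in> A" for g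
    proof (cases "U g = UNIV")
      case False
      then have "(g \<in> Q) = (g \<in> P)" using Q(2) g by blast
      moreover have "(g \<in> P) \<in> U g" using PiE_mem[OF U(2) g] g by simp
      ultimately show ?thesis by simp
    qed simp
    then have "?f Q \<in> Pi\<^sub>E A U" by (simp add: PiE_iff)
    then have "?f Q \<in> V" using U(3) by blast
    then show ?thesis using Q(1) by (simp add: V(2))
  qed
  then show thesis using that[of ?F] U(1) by blast
qed

section \<open>The space of left orderings\<close>

context group
begin

text \<open>Each cone axiom, for fixed elements, constrains at most three coordinates and hence defines a
clopen set; the axioms together form an intersection of such sets.\<close>

lemma closedin_LO: "closedin (powerset_topology (carrier G)) (LO G)"
proof -
  let ?X = "powerset_topology (carrier G)"
  let ?in = "\<lambda>g. {P \<in> Pow (carrier G). g \<in> P}"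
  let ?out = "\<lambda>g. {P \<in> Pow (carrier G). g \<notin> P}"
  define T where "T = (\<Inter>x\<in>carrier G. if x = \<one> then Pow (carrier G) else ?in x \<union> ?in (inv x))"
  define M where "M = (\<Inter>x\<in>carrier G. \<Inter>y\<in>carrier G. ?out x \<union> (?out y \<union> ?in (x \<otimes> y)))"
  have ne: "carrier G \<noteq> {}" using one_closed by blast
  have "closedin ?X T"
    unfolding T_def
  proof (intro closedin_INT ne)
    fix x assume x: "x \<in> carrier G"
    have "closedin ?X (Pow (carrier G))"
      using closedin_topspace[of ?X] by (simp only: topspace_powerset_topology)
    moreover have "closedin ?X (?in x \<union> ?in (inv x))"
      by (intro closedin_Un clopen_member x inv_closed)
    ultimately show "closedin ?X (if x = \<one> then Pow (carrier G) else ?in x \<union> ?in (inv x))"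
      by (cases "x = \<one>") simp_all
  qed
  moreover have "closedin ?X M"
    unfolding M_def by (intro closedin_INT ne closedin_Un clopen_member m_closed)
  moreover have "closedin ?X (?out \<one>)" by (intro clopen_member one_closed)
  ultimately have closed: "closedin ?X (?out \<one> \<inter> (M \<inter> T))" by (intro closedin_Int)
  have iff: "P \<in> LO G \<longleftrightarrow> P \<in> ?out \<one> \<inter> (M \<inter> T)" for P
  proof (cases "P \<subseteq> carrier G")
    case True
    have "P \<in> M \<longleftrightarrow> (\<forall>x\<in>carrier G. \<forall>y\<in>carrier G. x \<notin> P \<or> y \<notin> P \<or> x \<otimes> y \<in> P)"
      using True by (simp add: M_def) blast
    also have "\<dots> \<longleftrightarrow> (\<forall>x\<in>P. \<forall>y\<in>P. x \<otimes> y \<in> P)" using True by blast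
    finally have m: "P \<in> M \<longleftrightarrow> (\<forall>x\<in>P. \<forall>y\<in>P. x \<otimes> y \<in> P)" .
    have "P \<in> (if x = \<one> then Pow (carrier G) else ?in x \<union> ?in (inv x)) \<longleftrightarrow>
        x = \<one> \<or> x \<in> P \<or> inv x \<in> P" for x
      using True by simp
    then have t: "P \<in> T \<longleftrightarrow> (\<forall>x\<in>carrier G. x = \<one> \<or> x \<in> P \<or> inv x \<in> P)"
      by (simp only: T_def INT_iff)
    show ?thesis using True by (simp add: m t LO_eq left_cone_def)
  next
    case False
    then show ?thesis by (simp add: LO_eq left_cone_def)
  qed
  have "LO G = ?out \<one> \<inter> (M \<inter> T)" by (rule Set.set_eqI) (rule iff)
  then show ?thesis using closed by (simp only:)
qed

lemma LO_subset: "LO G \<subseteq> Pow (carrier G)"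
  by (auto simp: LO_eq left_cone_def)

lemma topspace_LO_space: "topspace (LO_space G) = LO G"
  using LO_subset by (auto simp: LO_space_def topspace_powerset_topology)

lemma compact_LO_space: "compact_space (LO_space G)"
  unfolding LO_space_def
  by (intro compact_space_subtopology closedin_compact_space compact_powerset_topology closedin_LO)

lemma clopen_LO:
  assumes "g \<in> carrier G"
  shows "openin (LO_space G) {P \<in> LO G. g \<in> P}" "closedin (LO_space G) {P \<in> LO G. g \<in> P}"
    and "openin (LO_space G) {P \<in> LO G. g \<notin> P}"
proof -
  have eq: "{P \<in> LO G. g \<in> P} = {P \<in> Pow (carrier G). g \<in> P} \<inter> LO G"
    "{P \<in> LO G. g \<notin> P} = {P \<in> Pow (carrier G). g \<notin> P} \<inter> LO G"
    using LO_subset by blast+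
  show "openin (LO_space G) {P \<in> LO G. g \<in> P}" "closedin (LO_space G) {P \<in> LO G. g \<in> P}"
    "openin (LO_space G) {P \<in> LO G. g \<notin> P}"
    unfolding eq LO_space_def openin_subtopology closedin_subtopology
    using clopen_member[OF assms] by blast+
qed

text \<open>For a cone, not containing \<open>g \<noteq> 1\<close> amounts to containing the inverse of \<open>g\<close>, so
neighbourhoods can be described by positive conditions alone.\<close>

lemma LO_neighbourhood:
  assumes W: "openin (LO_space G) W" and P: "P \<in> W"
  obtains F where "finite F" "F \<subseteq> P" "\<And>Q. \<lbrakk>Q \<in> LO G; F \<subseteq> Q\<rbrakk> \<Longrightarrow> Q \<in> W"
proof -
  obtain V where V: "openin (powerset_topology (carrier G)) V" "W = V \<inter> LO G"
    using W unfolding LO_space_def openin_subtopology by blast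
  have PL: "left_cone G P" using P V(2) by (simp add: LO_eq)
  interpret left_ordered_group G P using PL by unfold_locales
  have "P \<in> V" using P V(2) by blast
  then obtain E where E: "finite E" "E \<subseteq> carrier G"
    "\<And>Q. \<lbrakk>Q \<subseteq> carrier G; \<forall>g\<in>E. g \<in> Q \<longleftrightarrow> g \<in> P\<rbrakk> \<Longrightarrow> Q \<in> V"
    using powerset_topology_neighbourhood[OF V(1)] by metis
  \<comment> \<open>the elements of \<open>E\<close> that are positive, and the inverses of those that are negative\<close>
  define F where "F = (E \<union> (\<lambda>g. inv g) ` E) \<inter> P"
  have "Q \<in> W" if Q: "Q \<in> LO G" "F \<subseteq> Q" for Q
  proof -
    have QL: "left_cone G Q" using Q by (simp add: LO_eq)
    interpret Q: left_ordered_group G Q using QL by unfold_locales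
    have "g \<in> Q \<longleftrightarrow> g \<in> P" if g: "g \<in> E" for g
    proof
      assume "g \<in> P"
      then show "g \<in> Q" using g Q(2) by (auto simp: F_def)
    next
      assume gQ: "g \<in> Q"
      have "inv g \<notin> P"
      proof
        assume "inv g \<in> P"
        then have "inv g \<in> Q" using g Q(2) by (auto simp: F_def)
        then show False using Q.P_inv[OF gQ] by blast
      qed
      moreover have "g \<noteq> \<one>" using gQ Q.one_notin_P by blast
      ultimately show "g \<in> P" using P_cases[of g] g E(2) by blast
    qed
    then have "Q \<in> V" using E(3)[of Q] Q.P_carrier by blast
    then show ?thesis using Q(1) V(2) by blast
  qed
  moreover have "finite F" "F \<subseteq> P" using E(1) by (auto simp: F_def)
  ultimately show thesis using that by blast
qed

lemma dense_LO_subset_LO: "dense_LO G \<subseteq> LO G"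
  by (auto simp: dense_LO_eq LO_eq dense_cone_def)

text \<open>For fixed \<open>g\<close>, having an element strictly between \<open>1\<close> and \<open>g\<close> is a union
of open conditions, one for each candidate.\<close>

lemma gdelta_dense_LO:
  assumes count: "countable (carrier G)"
  shows "gdelta_in (LO_space G) (dense_LO G)"
proof -
  define D where "D g = {P \<in> LO G. g \<notin> P} \<union>
    (\<Union>f\<in>carrier G. {P \<in> LO G. f \<in> P} \<inter> {P \<in> LO G. inv f \<otimes> g \<in> P})" for g
  have "gdelta_in (LO_space G) (D g)" if "g \<in> carrier G" for g
    unfolding D_def using that
    by (intro open_imp_gdelta_in openin_Un openin_Union openin_Int clopen_LO ballI)
      (auto intro!: openin_Int clopen_LO)
  then have "gdelta_in (LO_space G) (\<Inter>g\<in>carrier G. D g)"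
    using count one_closed by (intro gdelta_in_Inter) auto
  moreover have "dense_LO G = (\<Inter>g\<in>carrier G. D g)"
  proof (intro equalityI subsetI)
    fix P assume P: "P \<in> dense_LO G"
    then have PL: "P \<in> LO G" and dense: "\<forall>g\<in>P. \<exists>f\<in>P. inv f \<otimes> g \<in> P" and sub: "P \<subseteq> carrier G"
      using dense_LO_subset_LO LO_subset by (auto simp: dense_LO_eq dense_cone_def)
    have "P \<in> D g" for g
    proof (cases "g \<in> P")
      case True
      then obtain f where "f \<in> P" "inv f \<otimes> g \<in> P" using dense by blast
      then show ?thesis unfolding D_def using PL sub by blast
    next
      case False
      then show ?thesis using PL by (simp add: D_def)
    qed
    then show "P \<in> (\<Inter>g\<in>carrier G. D g)" by simp
  next
    fix P assume P: "P \<in> (\<Inter>g\<in>carrier G. D g)"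
    then have "P \<in> D \<one>" by blast
    then have PL: "P \<in> LO G" by (auto simp: D_def)
    have "\<exists>f\<in>P. inv f \<otimes> g \<in> P" if g: "g \<in> P" for g
    proof -
      have "g \<in> carrier G" using g PL LO_subset by blast
      then have "P \<in> D g" using P by blast
      then show ?thesis using g unfolding D_def by blast
    qed
    then show "P \<in> dense_LO G" using PL by (simp add: dense_LO_eq LO_eq dense_cone_def)
  qed
  ultimately show ?thesis by simp
qed

text \<open>A limit of dense cones that is not itself dense is approximated by dense cones, which differ
from it. For a dense cone this is \<open>dense_cone_not_isolated\<close>; an extra positive element is put
into the finite set there because that set has to be nonempty, and nontriviality of the group
supplies one.\<close>

lemma closure_dense_LO_perfect:
  assumes "countable (carrier G)" and nontriv: "\<not> trivial_group G"
    and rank: "\<And>H. \<lbrakk>subgroup H G; abelian_of_rank (G\<lparr>carrier := H\<rparr>) 1\<rbrakk> \<Longrightarrow> G\<lparr>carrier := H\<rparr> \<cong> integer_group"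
    and W: "openin (LO_space G) W" "P \<in> W" and P: "P \<in> LO_space G closure_of dense_LO G"
  shows "\<exists>Q\<in>W \<inter> dense_LO G. Q \<noteq> P"
proof (cases "P \<in> dense_LO G")
  case False
  have "\<forall>T. P \<in> T \<and> openin (LO_space G) T \<longrightarrow> (\<exists>y. y \<in> dense_LO G \<and> y \<in> T)"
    using P unfolding in_closure_of by (rule conjunct2)
  then obtain Q where "Q \<in> dense_LO G" "Q \<in> W" using W by (elim allE[of _ W]) blast
  then show ?thesis using False by (intro bexI[of _ Q]) auto
next
  case True
  then have dense: "dense_cone G P" by (simp add: dense_LO_eq)
  then interpret left_ordered_group G P by unfold_locales (simp add: dense_cone_def)
  obtain F where F: "finite F" "F \<subseteq> P" "\<And>Q. \<lbrakk>Q \<in> LO G; F \<subseteq> Q\<rbrakk> \<Longrightarrow> Q \<in> W"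
    using LO_neighbourhood[OF W] by metis
  obtain x where x: "x \<in> carrier G" "x \<noteq> \<one>"
    using nontriv one_closed group_axioms unfolding trivial_group_def by blast
  then obtain p where p: "p \<in> P" using P_cases by blast
  have "\<exists>Q. dense_cone G Q \<and> insert p F \<subseteq> Q \<and> Q \<noteq> P"
  proof (rule dense_cone_not_isolated[OF dense assms(1)])
    show "G\<lparr>carrier := H\<rparr> \<cong> integer_group"
      if "subgroup H G" "abelian_of_rank (G\<lparr>carrier := H\<rparr>) 1" for H
      by (rule rank[OF that])
  qed (use F(1,2) p in auto)
  then obtain Q where Q: "dense_cone G Q" "insert p F \<subseteq> Q" "Q \<noteq> P" by blast
  have "Q \<in> dense_LO G" using Q(1) by (simp add: dense_LO_eq)
  moreover have "Q \<in> W"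
    using F(3)[of Q] Q(2) dense_LO_subset_LO calculation by auto
  ultimately show ?thesis using Q(3) by blast
qed

end

theorem theorem1p3:
  fixes G :: "('a, 'b) monoid_scheme"
  assumes "group G"
    and "countable (carrier G)"
    and "\<not> trivial_group G"
    and "\<And>H. subgroup H G \<Longrightarrow> abelian_of_rank (G\<lparr>carrier := H\<rparr>) 1 \<Longrightarrow>
           G\<lparr>carrier := H\<rparr> \<cong> integer_group"
    and "dense_LO G \<noteq> {}"
  shows "subtopology (LO_space G) (LO_space G closure_of dense_LO G)
           homeomorphic_space top_of_set cantor_set \<and>
         gdelta_in (LO_space G) (dense_LO G) \<and>
         subtopology (LO_space G) (LO_space G closure_of dense_LO G) closure_of dense_LO G
           = LO_space G closure_of dense_LO G"
proof -
  interpret group G by (rule assms(1))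
  let ?L = "LO_space G"
  let ?Z = "LO_space G closure_of dense_LO G"
  let ?enum = "from_nat_into (carrier G)"
  have ne: "carrier G \<noteq> {}" using one_closed by blast
  have ZZ: "dense_LO G \<subseteq> ?Z"
    using dense_LO_subset_LO by (intro closure_of_subset) (simp add: topspace_LO_space)
  have ZL: "?Z \<subseteq> LO G" using closure_of_subset_topspace[of ?L] by (simp add: topspace_LO_space)
  have top: "topspace (subtopology ?L ?Z) = ?Z" using ZL by (auto simp: topspace_LO_space)
  interpret perfect_clopen_space "subtopology ?L ?Z" "\<lambda>n. {P \<in> LO G. ?enum n \<in> P} \<inter> ?Z"
  proof
    show "compact_space (subtopology ?L ?Z)"
      by (intro compact_space_subtopology closedin_compact_space compact_LO_space closedin_closure_of)
    fix n
    have n: "?enum n \<in> carrier G" by (rule from_nat_into[OF ne])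
    show "openin (subtopology ?L ?Z) ({P \<in> LO G. ?enum n \<in> P} \<inter> ?Z)"
      using clopen_LO(1)[OF n] unfolding openin_subtopology by blast
    show "closedin (subtopology ?L ?Z) ({P \<in> LO G. ?enum n \<in> P} \<inter> ?Z)"
      using clopen_LO(2)[OF n] unfolding closedin_subtopology by blast
  next
    fix P Q assume PQ: "P \<in> topspace (subtopology ?L ?Z)" "Q \<in> topspace (subtopology ?L ?Z)"
      and same: "\<And>n. P \<in> {P \<in> LO G. ?enum n \<in> P} \<inter> ?Z \<longleftrightarrow> Q \<in> {P \<in> LO G. ?enum n \<in> P} \<inter> ?Z"
    have PQ: "P \<in> ?Z" "Q \<in> ?Z" "P \<in> LO G" "Q \<in> LO G" using PQ ZL unfolding top by blast+
    have mem: "g \<in> P \<longleftrightarrow> g \<in> Q" if g: "g \<in> carrier G" for g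
    proof -
      have "\<exists>n. ?enum n = g" by (rule from_nat_into_surj[OF assms(2) g])
      then obtain n where "?enum n = g" ..
      then show ?thesis using same[of n] PQ by simp
    qed
    have "P \<subseteq> carrier G" "Q \<subseteq> carrier G" using PQ(3,4) LO_subset by auto
    then show "P = Q" by (intro Set.equalityI subsetI) (auto simp: subset_iff mem)
  next
    fix V P assume V: "openin (subtopology ?L ?Z) V" "P \<in> V"
    then obtain W where W: "openin ?L W" "V = W \<inter> ?Z" unfolding openin_subtopology by blast
    have "\<exists>Q\<in>W \<inter> dense_LO G. Q \<noteq> P"
      using V(2) W by (intro closure_dense_LO_perfect assms) auto
    then show "\<exists>Q\<in>V. Q \<noteq> P" using ZZ W(2) by blast
  next
    show "topspace (subtopology ?L ?Z) \<noteq> {}" unfolding top using assms(5) ZZ by blast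
  qed
  have "subtopology ?L ?Z closure_of dense_LO G = ?Z"
    using ZZ by (simp add: closure_of_subtopology Int_absorb1)
  then show ?thesis
    by (intro conjI homeomorphic_cantor_set gdelta_dense_LO assms(2))
qed

end
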